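(* Let $\mathbb{L}$ be an $F$-finite field of prime characteristic $p>0$, let $R=\mathbb{L}[x_1,\dots,x_n]$ with $n\ge 1$, let $\mathfrak{m}=(x_1,\dots,x_n)$, and let $S=R_{\mathfrak{m}}$. Let $f\in\mathfrak{m}$ be such that the ideal $\operatorname{Jac}(f)$ is primary to $\mathfrak{m}$. Then there exist non-negative integers $N<M$ such that: (1) $\operatorname{fpt}(S,f)=\operatorname{fpt}(S,f+h)$ for every $h\in\mathfrak{m}^N$; (2) $\tau(S,f^{\lambda})=\tau(S,(f+h)^{\lambda})$ for every $h\in\mathfrak{m}^M$ and every real number $0\le\lambda<1$; in particular, for every $h\in\mathfrak{m}^M$, the elements $f$ and $f+h$ have the same $F$-jumping numbers in $S$, i.e. $\mathbb{J}(S,f)=\mathbb{J}(S,f+h)$.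
   Context: A field $\mathbb{L}$ of characteristic $p>0$ is $F$-finite if $[\mathbb{L}:\mathbb{L}^p]<\infty$. For $f\in R=\mathbb{L}[x_1,\dots,x_n]$, $\operatorname{Jac}(f)$ denotes the ideal of $R$ generated by $f$ and all of its partial derivatives $\partial f/\partial x_i$. Let $A$ be an $F$-finite regular ring of characteristic $p$ (here $A=S$) and $g\in A$. For an ideal $\mathfrak{b}$ and $e\ge 0$, $\mathfrak{b}^{[p^e]}$ is the ideal generated by the $p^e$-th powers of elements of $\mathfrak{b}$. For $g\in A$ and $e\ge 1$, $(g)^{[1/p^e]}$ is the smallest ideal $\mathfrak{b}$ of $A$ with $g\in\mathfrak{b}^{[p^e]}$ (it exists because $A$ is regular and $F$-finite). For a real $\lambda\ge 0$, the test ideal is $\tau(A,g^{\lambda})=\bigcup_{e\ge1}\bigl(g^{\lceil p^e\lambda\rceil}\bigr)^{[1/p^e]}$ (an ascending union, which stabilizes). A real number $\xi\ge0$ is an $F$-jumping number of $(A,g)$ if $\xi=0$, or $\xi>0$ and $\tau(A,g^{\xi})\ne\tau(A,g^{\xi-\varepsilon})$ for every $0<\varepsilon<\xi$; $\mathbb{J}(A,g)$ is the set of all $F$-jumping numbers. The $F$-pure threshold is $\operatorname{fpt}(A,g)=\sup\{\lambda>0:\tau(A,g^{\lambda})=A\}$. Elements of $R$ are regarded as elements of $S$ via localization. *)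

theory Defs
  imports
    "HOL-Library.Poly_Mapping"
    "HOL-Library.Extended_Nonnegative_Real"
    "HOL-Computational_Algebra.Primes"
    "HOL-Computational_Algebra.Fraction_Field"
begin

section \<open>Ideals of commutative rings\<close>

text \<open>Ideals of a commutative ring are its submodules as a module over itself.\<close>

global_interpretation self_module: module "(*) :: 'a::comm_ring_1 \<Rightarrow> 'a \<Rightarrow> 'a"
  defines ring_ideal = self_module.subspace
    and ideal_gen = self_module.span
  by standard (simp_all add: algebra_simps)

definition ideal_prod :: "'a::comm_ring_1 set \<Rightarrow> 'a set \<Rightarrow> 'a set" where
  "ideal_prod I J = ideal_gen {a * b | a b. a \<in> I \<and> b \<in> J}"

primrec ideal_power :: "'a::comm_ring_1 set \<Rightarrow> nat \<Rightarrow> 'a set" where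
  "ideal_power I 0 = UNIV"
| "ideal_power I (Suc k) = ideal_prod I (ideal_power I k)"

definition ideal_radical :: "'a::comm_ring_1 set \<Rightarrow> 'a set" where
  "ideal_radical I = {a. \<exists>k>0. a ^ k \<in> I}"

definition primary_ideal :: "'a::comm_ring_1 set \<Rightarrow> bool" where
  "primary_ideal I \<longleftrightarrow> ring_ideal I \<and> I \<noteq> UNIV \<and>
     (\<forall>a b. a * b \<in> I \<longrightarrow> a \<in> I \<or> (\<exists>k>0. b ^ k \<in> I))"

definition primary_to :: "'a::comm_ring_1 set \<Rightarrow> 'a set \<Rightarrow> bool" where
  "primary_to P I \<longleftrightarrow> primary_ideal I \<and> ideal_radical I = P"

section \<open>Fields that are finite over their subfield of p-th powers\<close>

text \<open>A field has finite degree over a subfield \<open>K\<close> iff it is spanned over \<open>K\<close> by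
  a finite set.\<close>

definition finite_degree_over :: "'a::field set \<Rightarrow> bool" where
  "finite_degree_over K \<longleftrightarrow>
     (\<exists>B. finite B \<and> (\<forall>x. \<exists>c. (\<forall>b\<in>B. c b \<in> K) \<and> x = (\<Sum>b\<in>B. c b * b)))"

definition F_finite_field :: "'a::field itself \<Rightarrow> bool" where
  "F_finite_field _ \<longleftrightarrow> finite_degree_over (range (\<lambda>x::'a. x ^ CHAR('a)))"

section \<open>Test ideals of principal ideals\<close>

text \<open>These are meant for rings of prime characteristic that are regular and F-finite; this
  guarantees that the least ideal in the definition of \<open>frobenius_root\<close> exists.\<close>

definition frobenius_power :: "'a::comm_ring_1 set \<Rightarrow> nat \<Rightarrow> 'a set" where
  "frobenius_power I e = ideal_gen ((\<lambda>x. x ^ (CHAR('a) ^ e)) ` I)"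

definition frobenius_root :: "'a::comm_ring_1 \<Rightarrow> nat \<Rightarrow> 'a set" where
  "frobenius_root g e = (LEAST I. ring_ideal I \<and> g \<in> frobenius_power I e)"

definition test_ideal :: "'a::comm_ring_1 \<Rightarrow> real \<Rightarrow> 'a set" where
  "test_ideal g t = (\<Union>e\<in>{1..}. frobenius_root (g ^ nat \<lceil>real (CHAR('a) ^ e) * t\<rceil>) e)"

definition F_jumping_numbers :: "'a::comm_ring_1 \<Rightarrow> real set" where
  "F_jumping_numbers g = {\<xi>. \<xi> = 0 \<or>
     (\<xi> > 0 \<and> (\<forall>\<epsilon>. 0 < \<epsilon> \<and> \<epsilon> < \<xi> \<longrightarrow> test_ideal g \<xi> \<noteq> test_ideal g (\<xi> - \<epsilon>)))}"

text \<open>The supremum is taken in the extended non-negative reals: it is infinite for units, and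
  \<open>0\<close> when the set is empty (as for \<open>g = 0\<close>).\<close>

definition fpt :: "'a::comm_ring_1 \<Rightarrow> ennreal" where
  "fpt g = (SUP t\<in>{t::real. t > 0 \<and> test_ideal g t = UNIV}. ennreal t)"

section \<open>Polynomials\<close>

text \<open>Polynomials over \<open>'a\<close> in variables indexed by \<open>'n\<close>. The linear order on \<open>'n\<close> required
  below is only used by the library to show that the polynomial ring is an integral domain.\<close>

type_synonym ('n, 'a) mpoly = "('n \<Rightarrow>\<^sub>0 nat) \<Rightarrow>\<^sub>0 'a"

definition Var :: "'n \<Rightarrow> ('n, 'a::comm_ring_1) mpoly" where
  "Var i = Poly_Mapping.single (Poly_Mapping.single i 1) 1"

definition partial_deriv :: "'n \<Rightarrow> ('n, 'a::comm_ring_1) mpoly \<Rightarrow> ('n, 'a) mpoly" where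
  "partial_deriv i f = (\<Sum>k\<in>Poly_Mapping.keys f.
     Poly_Mapping.single (k - Poly_Mapping.single i 1)
       (of_nat (Poly_Mapping.lookup k i) * Poly_Mapping.lookup f k))"

definition Jac :: "('n, 'a::comm_ring_1) mpoly \<Rightarrow> ('n, 'a) mpoly set" where
  "Jac f = ideal_gen (insert f (range (\<lambda>i. partial_deriv i f)))"

definition origin_ideal :: "('n, 'a::comm_ring_1) mpoly set" where
  "origin_ideal = ideal_gen (range Var)"

lemma lookup_zero_times:
  fixes f g :: "('n, 'a::comm_ring_1) mpoly"
  shows "Poly_Mapping.lookup (f * g) 0 = Poly_Mapping.lookup f 0 * Poly_Mapping.lookup g 0"
proof -
  have split: "(0 = l + q) \<longleftrightarrow> l = 0 \<and> q = 0" for l q :: "'n \<Rightarrow>\<^sub>0 nat"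
    by (auto simp: poly_mapping_eq_iff fun_eq_iff lookup_add)
  have inner: "Sum_any (\<lambda>q. Poly_Mapping.lookup g q when 0 = l + q) =
      (Poly_Mapping.lookup g 0 when l = 0)" for l :: "'n \<Rightarrow>\<^sub>0 nat"
  proof (cases "l = 0")
    case True
    then show ?thesis by simp
  next
    case False
    then show ?thesis by (simp add: split)
  qed
  have "Poly_Mapping.lookup (f * g) 0 =
      Sum_any (\<lambda>l. Poly_Mapping.lookup f l * (Poly_Mapping.lookup g 0 when l = 0))"
    by (simp only: times_poly_mapping.rep_eq prod_fun_def inner)
  also have "\<dots> = Sum_any (\<lambda>l. Poly_Mapping.lookup f l * Poly_Mapping.lookup g 0 when l = 0)"
    by (simp add: mult_when)
  finally show ?thesis by simp
qed

lemma single_in_origin_ideal: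
  assumes "k \<noteq> 0"
  shows "Poly_Mapping.single k c \<in> (origin_ideal :: ('n, 'a::comm_ring_1) mpoly set)"
proof -
  obtain i where i: "Poly_Mapping.lookup k i \<noteq> 0"
    using assms by (auto simp: poly_mapping_eq_iff fun_eq_iff)
  have k: "(k - Poly_Mapping.single i 1) + Poly_Mapping.single i 1 = k"
    using i by (auto simp: poly_mapping_eq_iff fun_eq_iff lookup_add lookup_minus lookup_single when_def)
  have "Poly_Mapping.single k c = Poly_Mapping.single (k - Poly_Mapping.single i 1) c * Var i"
    unfolding Var_def mult_single k by simp
  then show ?thesis
    unfolding origin_ideal_def by (auto intro: self_module.span_scale self_module.span_base)
qed

lemma mem_origin_ideal_iff:
  fixes f :: "('n, 'a::comm_ring_1) mpoly"
  shows "f \<in> origin_ideal \<longleftrightarrow> Poly_Mapping.lookup f 0 = 0"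
proof
  have "ring_ideal {g :: ('n, 'a) mpoly. Poly_Mapping.lookup g 0 = 0}"
    by (rule self_module.subspaceI) (auto simp: lookup_add lookup_zero_times)
  moreover have "range Var \<subseteq> {g :: ('n, 'a) mpoly. Poly_Mapping.lookup g 0 = 0}"
    by (auto simp: Var_def lookup_single when_def poly_mapping_eq_iff fun_eq_iff)
  ultimately have "origin_ideal \<subseteq> {g :: ('n, 'a) mpoly. Poly_Mapping.lookup g 0 = 0}"
    unfolding origin_ideal_def by (intro self_module.span_minimal)
  then show "f \<in> origin_ideal \<Longrightarrow> Poly_Mapping.lookup f 0 = 0" by auto
next
  assume f: "Poly_Mapping.lookup f 0 = 0"
  have "f = (\<Sum>k\<in>Poly_Mapping.keys f. Poly_Mapping.single k (Poly_Mapping.lookup f k))"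
    by (rule poly_mapping_eqI)
      (auto simp: lookup_sum lookup_single when_def in_keys_iff)
  moreover have "\<dots> \<in> origin_ideal"
    using f unfolding origin_ideal_def
    by (intro self_module.span_sum)
      (metis in_keys_iff single_in_origin_ideal origin_ideal_def)
  ultimately show "f \<in> origin_ideal" by simp
qed

lemma origin_ideal_complement:
  fixes f g :: "('n, 'a::idom) mpoly"
  shows "1 \<notin> (origin_ideal :: ('n, 'a) mpoly set)" "0 \<in> (origin_ideal :: ('n, 'a) mpoly set)"
    "f * g \<in> origin_ideal \<longleftrightarrow> f \<in> origin_ideal \<or> g \<in> origin_ideal"
  by (auto simp: mem_origin_ideal_iff lookup_zero_times)

section \<open>The localization at the origin\<close>

definition origin_fractions :: "('n::linorder, 'a::field) mpoly fract set" where
  "origin_fractions = {Fract a b | a b. b \<notin> origin_ideal}"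

lemma origin_fractions_closed:
  fixes x y :: "('n::linorder, 'a::field) mpoly fract"
  shows "(0 :: ('n, 'a) mpoly fract) \<in> origin_fractions"
    and "(1 :: ('n, 'a) mpoly fract) \<in> origin_fractions"
    and "x \<in> origin_fractions \<Longrightarrow> - x \<in> origin_fractions"
    and "x \<in> origin_fractions \<Longrightarrow> y \<in> origin_fractions \<Longrightarrow> x + y \<in> origin_fractions"
    and "x \<in> origin_fractions \<Longrightarrow> y \<in> origin_fractions \<Longrightarrow> x - y \<in> origin_fractions"
    and "x \<in> origin_fractions \<Longrightarrow> y \<in> origin_fractions \<Longrightarrow> x * y \<in> origin_fractions"
proof -
  have A: "Fract a b \<in> origin_fractions" if "b \<notin> origin_ideal" for a b :: "('n, 'a) mpoly"
    unfolding origin_fractions_def using that by blast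
  have nonzero: "b \<noteq> 0" if "b \<notin> origin_ideal" for b :: "('n, 'a) mpoly"
    using that origin_ideal_complement(2) by metis
  show "(0 :: ('n, 'a) mpoly fract) \<in> origin_fractions"
    "(1 :: ('n, 'a) mpoly fract) \<in> origin_fractions"
    unfolding Zero_fract_def One_fract_def by (rule A, rule origin_ideal_complement(1))+
  have elim: "\<exists>a b. z = Fract a b \<and> b \<notin> origin_ideal" if "z \<in> origin_fractions"
    for z :: "('n, 'a) mpoly fract"
    using that unfolding origin_fractions_def by blast
  show "- x \<in> origin_fractions" if x: "x \<in> origin_fractions"
  proof -
    obtain a b where "x = Fract a b" "b \<notin> origin_ideal" using elim[OF x] by metis
    then show ?thesis by (simp only: minus_fract A not_False_eq_True)
  qed
  show "x + y \<in> origin_fractions" "x - y \<in> origin_fractions" "x * y \<in> origin_fractions"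
    if x: "x \<in> origin_fractions" and y: "y \<in> origin_fractions"
  proof -
    obtain a b where ab: "x = Fract a b" "b \<notin> origin_ideal" using elim[OF x] by metis
    obtain c d where cd: "y = Fract c d" "d \<notin> origin_ideal" using elim[OF y] by metis
    have bd: "b * d \<notin> origin_ideal" using ab(2) cd(2) by (simp add: origin_ideal_complement(3))
    note nz = nonzero[OF ab(2)] nonzero[OF cd(2)]
    show "x + y \<in> origin_fractions" unfolding ab(1) cd(1) add_fract[OF nz] by (rule A[OF bd])
    show "x - y \<in> origin_fractions" unfolding ab(1) cd(1) diff_fract[OF nz] by (rule A[OF bd])
    show "x * y \<in> origin_fractions" unfolding ab(1) cd(1) mult_fract by (rule A[OF bd])
  qed
qed

typedef (overloaded) ('n::"{finite,linorder}", 'a::field) local_ring =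
  "origin_fractions :: ('n, 'a) mpoly fract set"
  morphisms fract_of Abs_local
  using origin_fractions_closed(1) by blast

setup_lifting type_definition_local_ring

instantiation local_ring :: ("{finite,linorder}", field) idom
begin

lift_definition zero_local_ring :: "('a, 'b) local_ring" is 0
  by (rule origin_fractions_closed)

lift_definition one_local_ring :: "('a, 'b) local_ring" is 1
  by (rule origin_fractions_closed)

lift_definition plus_local_ring ::
    "('a, 'b) local_ring \<Rightarrow> ('a, 'b) local_ring \<Rightarrow> ('a, 'b) local_ring" is "(+)"
  by (rule origin_fractions_closed)

lift_definition uminus_local_ring :: "('a, 'b) local_ring \<Rightarrow> ('a, 'b) local_ring" is uminus
  by (rule origin_fractions_closed)

lift_definition minus_local_ring ::
    "('a, 'b) local_ring \<Rightarrow> ('a, 'b) local_ring \<Rightarrow> ('a, 'b) local_ring" is "(-)"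
  by (rule origin_fractions_closed)

lift_definition times_local_ring ::
    "('a, 'b) local_ring \<Rightarrow> ('a, 'b) local_ring \<Rightarrow> ('a, 'b) local_ring" is "(*)"
  by (rule origin_fractions_closed)

instance
proof
  fix a b c :: "('a, 'b) local_ring"
  note rep = zero_local_ring.rep_eq one_local_ring.rep_eq plus_local_ring.rep_eq
    uminus_local_ring.rep_eq minus_local_ring.rep_eq times_local_ring.rep_eq
  note eq = fract_of_inject[symmetric]
  show "a * b * c = a * (b * c)" by (simp only: eq rep mult.assoc)
  show "a * b = b * a" unfolding eq rep by (rule mult.commute)
  show "1 * a = a" by (simp only: eq rep mult_1_left)
  show "a + b + c = a + (b + c)" by (simp only: eq rep add.assoc)
  show "a + b = b + a" unfolding eq rep by (rule add.commute)
  show "0 + a = a" by (simp only: eq rep add_0_left)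
  show "- a + a = 0" by (simp only: eq rep left_minus)
  show "a - b = a + - b" unfolding eq rep by (rule diff_conv_add_uminus)
  show "(a + b) * c = a * c + b * c" by (simp only: eq rep distrib_right)
  show "a * (b + c) = a * b + a * c" by (simp only: eq rep distrib_left)
  show "0 * a = 0" "a * 0 = 0" by (simp_all only: eq rep mult_zero_left mult_zero_right)
  show "(0 :: ('a, 'b) local_ring) \<noteq> 1" unfolding eq rep by (rule zero_neq_one)
  show "a \<noteq> 0 \<Longrightarrow> b \<noteq> 0 \<Longrightarrow> a * b \<noteq> 0" unfolding eq rep by (rule no_zero_divisors)
qed

end

definition to_local :: "('n::{finite,linorder}, 'a::field) mpoly \<Rightarrow> ('n, 'a) local_ring" where
  "to_local f = Abs_local (Fract f 1)"

lemma fract_of_to_local: "fract_of (to_local f) = Fract f 1"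
proof -
  have "Fract f 1 \<in> origin_fractions"
    unfolding origin_fractions_def using origin_ideal_complement(1) by blast
  then show ?thesis
    unfolding to_local_def by (rule Abs_local_inverse)
qed

lemma CHAR_local_ring: "CHAR(('n::{finite,linorder}, 'a::field) local_ring) = CHAR('a)"
proof -
  have of_nat: "fract_of (of_nat k :: ('n, 'a) local_ring) = of_nat k" for k
    by (induction k) (simp_all add: zero_local_ring.rep_eq one_local_ring.rep_eq
        plus_local_ring.rep_eq)
  have "(of_nat k :: ('n, 'a) local_ring) = 0 \<longleftrightarrow> (of_nat k :: 'a) = 0" for k
  proof -
    have "(of_nat k :: ('n, 'a) local_ring) = 0 \<longleftrightarrow>
        (of_nat k :: ('n, 'a) mpoly fract) = 0"
      by (simp add: fract_of_inject[symmetric] zero_local_ring.rep_eq of_nat)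
    also have "\<dots> \<longleftrightarrow> (of_nat k :: ('n, 'a) mpoly) = 0"
      by (simp add: of_nat_fract Zero_fract_def eq_fract)
    also have "\<dots> \<longleftrightarrow> (of_nat k :: 'a) = 0"
    proof -
      have "(of_nat k :: ('n, 'a) mpoly) = Poly_Mapping.single 0 (of_nat k)"
        by (rule single_of_nat[symmetric])
      moreover have "Poly_Mapping.single (0 :: 'n \<Rightarrow>\<^sub>0 nat) (of_nat k :: 'a) = 0 \<longleftrightarrow> (of_nat k :: 'a) = 0"
        by (metis lookup_single_eq lookup_zero single_zero)
      ultimately show ?thesis by (simp only:)
    qed
    finally show ?thesis .
  qed
  then show ?thesis
    by (intro CHAR_eqI) (simp_all only: of_nat_CHAR of_nat_eq_0_iff_char_dvd[symmetric])
qed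

end

(* The p^e-th roots are controlled by the R-linear maps \<phi> from F^e_* R to R: with q = p^e,
   g lies in I^[q] iff all \<phi>(g) lie in I.

   Ideals of the form K = I^[p] are stable under derivations. Hence, for 0 < b < p, if f^b z \<in> K for
   all z in Jac(f)^c, then f^(b-1) z \<in> K for all z in Jac(f)^(c+2). Let a < q and let J be the
   contraction to R of an ideal of S. Peeling off the base-p digits of a one at a time, this shows that
   f^a \<in> J^[q] implies (f+h)^a \<in> J^[q] as soon as h \<in> Jac(f)^4 in S. If h lies in a high power of the
   maximal ideal, then Jac(f) is contained in Jac(f+h) in S by Nakayama's lemma, so the roles of f and
   f+h can be exchanged, and the Frobenius roots of f^a and (f+h)^a coincide for all a < q. The jumping
   numbers outside (0,1) follow from \<tau>(f^(t+1)) = f \<tau>(f^t) and the fact that 1 always is one. *)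
theory Submission
  imports Defs
begin

text \<open>Derivations and the coordinates of Frobenius are used on R, so ideals of S enter through
  their contractions and denominators are cancelled in R. This works because R is free over its
  subring of q-th powers: Frobenius powers commute with colons, (I^[q] : c^q) = (I : c)^[q], and
  I^[q] inherits from I that a given element can be cancelled. The assumption on h takes the same
  form: some u outside the maximal ideal multiplies h into Jac(f)^4.

  Digits are needed because differentiating f^b brings down the factor b, which is invertible only
  if p does not divide it. Once the lowest digit is split off, membership of f^a becomes a statement
  about f^(a div p) times a whole colon ideal. The induction therefore carries a set W of
  multipliers, with the invariant that W contains Jac(f)^2. The exponents 2 and 4 come from the rule
  that lowering the power of f by j costs 2j Jacobian factors: the p-th power of an element of
  Jac(f)^2 pays for a digit below p on top of the initial 2, and each h in Jac(f)^4 pays for the f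
  that it replaces.\<close>

declare self_module.scale_scale [simp del] \<comment> \<open>loops with \<open>mult.assoc\<close>\<close>

section \<open>Frobenius powers of ideals\<close>

lemma ideal_gen_minimal: "X \<subseteq> I \<Longrightarrow> ring_ideal I \<Longrightarrow> ideal_gen X \<subseteq> I"
  by (rule self_module.span_minimal)

lemma ring_ideal_ideal_gen [simp, intro]: "ring_ideal (ideal_gen X)"
  by (rule self_module.subspace_span)

lemma ring_ideal_UNIV [simp, intro]: "ring_ideal UNIV"
  by (rule self_module.subspace_UNIV)

lemma ring_ideal_mult_left: "ring_ideal I \<Longrightarrow> x \<in> I \<Longrightarrow> r * x \<in> I"
  by (rule self_module.subspace_scale)

lemma ring_ideal_mult_right: "ring_ideal I \<Longrightarrow> x \<in> I \<Longrightarrow> x * r \<in> I"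
  by (metis mult.commute ring_ideal_mult_left)

text \<open>The colon ideal (I : c). It reduces statements c * z \<in> I, for z in a generated
  ideal, to the generators.\<close>

lemma ring_ideal_colon:
  assumes "ring_ideal I"
  shows "ring_ideal {z. c * z \<in> I}"
proof (rule self_module.subspaceI)
  show "r * z \<in> {z. c * z \<in> I}" if "z \<in> {z. c * z \<in> I}" for r z
    using that ring_ideal_mult_left[OF assms, of "c * z" r] by (metis mem_Collect_eq mult.left_commute)
qed (use assms in \<open>auto simp: self_module.subspace_0 distrib_left self_module.subspace_add\<close>)

lemma ring_ideal_frobenius_power [simp, intro]: "ring_ideal (frobenius_power I e)"
  by (simp add: frobenius_power_def)

lemma power_in_frobenius_power:
  fixes x :: "'a::comm_ring_1"
  shows "x \<in> I \<Longrightarrow> x ^ (CHAR('a) ^ e) \<in> frobenius_power I e"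
  by (auto simp: frobenius_power_def intro: self_module.span_base)

lemma frobenius_power_mono: "I \<subseteq> J \<Longrightarrow> frobenius_power I e \<subseteq> frobenius_power J e"
  unfolding frobenius_power_def by (intro self_module.span_mono image_mono)

lemma power_frobenius_power:
  fixes x :: "'a::comm_ring_1"
  assumes p: "prime CHAR('a)" and x: "x \<in> frobenius_power I d"
  shows "x ^ (CHAR('a) ^ e) \<in> frobenius_power I (d + e)"
  using x unfolding frobenius_power_def[of I d]
proof (induction rule: self_module.span_induct_alt)
  case base
  have "(0::'a) ^ (CHAR('a) ^ e) = 0" using p by (simp add: zero_power prime_gt_0_nat)
  then show ?case using self_module.subspace_0[OF ring_ideal_frobenius_power] by metis
next
  case (step c x y)
  obtain z where z: "z \<in> I" "x = z ^ (CHAR('a) ^ d)" using step by auto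
  have "(c * x + y) ^ (CHAR('a) ^ e) =
      c ^ (CHAR('a) ^ e) * z ^ (CHAR('a) ^ (d + e)) + y ^ (CHAR('a) ^ e)"
    using p by (simp add: freshmans_dream' power_mult_distrib z(2) power_add flip: power_mult)
  then show ?case using step power_in_frobenius_power[OF z(1), of "d + e"]
    by (simp add: self_module.subspace_add self_module.subspace_scale)
qed

text \<open>Allows one factor p to be split off p^(e+1), as the ascent of the roots and the digit
  induction require.\<close>

lemma frobenius_power_frobenius_power:
  fixes I :: "'a::comm_ring_1 set"
  assumes p: "prime CHAR('a)"
  shows "frobenius_power (frobenius_power I d) e = frobenius_power I (d + e)"
proof
  show "frobenius_power (frobenius_power I d) e \<subseteq> frobenius_power I (d + e)"
    unfolding frobenius_power_def[of _ e]
    by (intro ideal_gen_minimal) (auto intro: power_frobenius_power[OF p])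
  have "x ^ (CHAR('a) ^ (d + e)) \<in> frobenius_power (frobenius_power I d) e" if "x \<in> I" for x
    using power_in_frobenius_power[OF power_in_frobenius_power[OF that, of d], of e]
    by (simp add: power_add power_mult)
  then show "frobenius_power I (d + e) \<subseteq> frobenius_power (frobenius_power I d) e"
    unfolding frobenius_power_def[of I "d + e"]
    by (intro ideal_gen_minimal) auto
qed

text \<open>These maps are the \<open>R\<close>-linear maps \<open>F\<^sup>e\<^sub>* R \<rightarrow> R\<close>.\<close>

definition frobenius_linear :: "nat \<Rightarrow> ('a::comm_ring_1 \<Rightarrow> 'a) \<Rightarrow> bool" where
  "frobenius_linear e \<phi> \<longleftrightarrow> (\<forall>x y. \<phi> (x + y) = \<phi> x + \<phi> y) \<and>
     (\<forall>r x. \<phi> (r ^ (CHAR('a) ^ e) * x) = r * \<phi> x)"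

lemma frobenius_linear_frobenius_power:
  fixes \<phi> :: "'a::comm_ring_1 \<Rightarrow> 'a"
  assumes I: "ring_ideal I" and \<phi>: "frobenius_linear e \<phi>" and x: "x \<in> frobenius_power I e"
  shows "\<phi> x \<in> I"
  using x unfolding frobenius_power_def
proof (induction rule: self_module.span_induct_alt)
  case base
  have "\<phi> 0 = 0" using \<phi> by (metis add_cancel_right_right add.right_neutral frobenius_linear_def)
  then show ?case using I self_module.subspace_0 by metis
next
  case (step c x y)
  then obtain z where "z \<in> I" "x = z ^ (CHAR('a) ^ e)" by auto
  then have "\<phi> (c * x + y) = z * \<phi> c + \<phi> y"
    using \<phi> by (metis frobenius_linear_def mult.commute)
  then show ?case using step I \<open>z \<in> I\<close>
    by (simp add: self_module.subspace_add ring_ideal_mult_right)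
qed

section \<open>Polynomials over a field of prime characteristic\<close>

lemma CHAR_mpoly: "CHAR(('n, 'a::comm_ring_1) mpoly) = CHAR('a)"
proof -
  have "(of_nat k :: ('n, 'a) mpoly) = 0 \<longleftrightarrow> (of_nat k :: 'a) = 0" for k
  proof -
    have "(of_nat k :: ('n, 'a) mpoly) = Poly_Mapping.single 0 (of_nat k)"
      by (rule single_of_nat[symmetric])
    moreover have "Poly_Mapping.single (0 :: 'n \<Rightarrow>\<^sub>0 nat) (of_nat k :: 'a) = 0 \<longleftrightarrow> (of_nat k :: 'a) = 0"
      by (metis lookup_single_eq lookup_zero single_zero)
    ultimately show ?thesis by (simp only:)
  qed
  then show ?thesis
    by (intro CHAR_eqI) (simp_all only: of_nat_CHAR of_nat_eq_0_iff_char_dvd[symmetric])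
qed

lemma mpoly_eq_sum_single:
  "(g :: ('n, 'a::comm_ring_1) mpoly) =
     (\<Sum>k\<in>Poly_Mapping.keys g. Poly_Mapping.single k (Poly_Mapping.lookup g k))"
  by (rule poly_mapping_eqI) (auto simp: lookup_sum lookup_single when_def in_keys_iff)

lemma mpoly_induct [case_names single add]:
  fixes g :: "('n, 'a::comm_ring_1) mpoly"
  assumes single: "\<And>k c. P (Poly_Mapping.single k c)"
    and add: "\<And>f g. P f \<Longrightarrow> P g \<Longrightarrow> P (f + g)"
  shows "P g"
proof -
  have "P (\<Sum>k\<in>A. Poly_Mapping.single k (Poly_Mapping.lookup g k))" if "finite A" for A
    using that
  proof induction
    case empty
    show ?case using single[of 0 0] by simp
  qed (simp add: single add)
  then show ?thesis using mpoly_eq_sum_single[of g] by (metis finite_keys)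
qed

section \<open>Coordinates of polynomials over the subring of q-th powers\<close>

lemma lookup_map_0:
  "f 0 = 0 \<Longrightarrow> Poly_Mapping.lookup (Poly_Mapping.map f k) i = f (Poly_Mapping.lookup k i)"
  by (simp add: map.rep_eq when_def)

lemma single_power:
  "Poly_Mapping.single k c ^ m = Poly_Mapping.single (Poly_Mapping.map ((*) m) k) (c ^ m)"
  for k :: "'n \<Rightarrow>\<^sub>0 nat" and c :: "'a::comm_ring_1"
proof (induction m)
  case 0
  have "Poly_Mapping.map (\<lambda>_. 0 :: nat) k = 0"
    by (rule poly_mapping_eqI) (simp add: lookup_map_0)
  then show ?case by (simp add: mult_zero_left[abs_def])
next
  case (Suc m)
  have "k + Poly_Mapping.map ((*) m) k = Poly_Mapping.map ((*) (Suc m)) k"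
    by (rule poly_mapping_eqI) (simp add: lookup_map_0 lookup_add)
  then show ?case by (simp only: power_Suc Suc mult_single)
qed

text \<open>If q = p^e and \<open>l\<close> is the coordinate at b for a basis of the field over its
  q-th powers, this is the coordinate at b x^\<alpha> over the q-th powers of polynomials, with the
  q-th root already taken: x^k contributes to x^(k div q) when k mod q = \<alpha>.\<close>

definition residue_part :: "nat \<Rightarrow> ('n \<Rightarrow>\<^sub>0 nat) \<Rightarrow> ('a \<Rightarrow> 'a) \<Rightarrow> ('n, 'a::comm_ring_1) mpoly \<Rightarrow> ('n, 'a) mpoly"
  where "residue_part q \<alpha> l g = (\<Sum>k\<in>Poly_Mapping.keys g.
     if Poly_Mapping.map (\<lambda>x. x mod q) k = \<alpha>
     then Poly_Mapping.single (Poly_Mapping.map (\<lambda>x. x div q) k) (l (Poly_Mapping.lookup g k)) else 0)"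

lemma residue_part_superset:
  assumes "l 0 = 0" "finite A" "Poly_Mapping.keys g \<subseteq> A"
  shows "residue_part q \<alpha> l g = (\<Sum>k\<in>A.
     if Poly_Mapping.map (\<lambda>x. x mod q) k = \<alpha>
     then Poly_Mapping.single (Poly_Mapping.map (\<lambda>x. x div q) k) (l (Poly_Mapping.lookup g k)) else 0)"
  unfolding residue_part_def using assms
  by (intro sum.mono_neutral_left) (auto simp: in_keys_iff)

lemma residue_part_single:
  assumes "l 0 = 0"
  shows "residue_part q \<alpha> l (Poly_Mapping.single k c) =
     (if Poly_Mapping.map (\<lambda>x. x mod q) k = \<alpha>
      then Poly_Mapping.single (Poly_Mapping.map (\<lambda>x. x div q) k) (l c) else 0)"
  using residue_part_superset[of l "{k}" "Poly_Mapping.single k c" q \<alpha>] assms by simp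

lemma residue_part_add:
  assumes l: "\<And>x y. l (x + y) = l x + l y"
  shows "residue_part q \<alpha> l (f + g) = residue_part q \<alpha> l f + residue_part q \<alpha> l g"
proof -
  have l0: "l 0 = 0" using l[of 0 0] by simp
  let ?A = "Poly_Mapping.keys f \<union> Poly_Mapping.keys g"
  have "Poly_Mapping.keys (f + g) \<subseteq> ?A" by (rule keys_add)
  then show ?thesis
    using residue_part_superset[of l ?A f q \<alpha>, OF l0] residue_part_superset[of l ?A g q \<alpha>, OF l0]
      residue_part_superset[of l ?A "f + g" q \<alpha>, OF l0]
    by (auto simp: lookup_add l single_add simp flip: sum.distrib intro!: sum.cong)
qed

text \<open>On monomials, multiplying by (x^k)^q keeps exponents mod q and adds k to their
  quotients; additivity of Frobenius does the rest.\<close>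

lemma frobenius_linear_residue_part:
  fixes l :: "'a::comm_ring_1 \<Rightarrow> 'a"
  assumes p: "prime CHAR('a)" and l: "frobenius_linear e l"
  shows "frobenius_linear e (residue_part (CHAR('a) ^ e) \<alpha> l :: ('n, 'a) mpoly \<Rightarrow> _)"
proof -
  let ?q = "CHAR('a) ^ e"
  let ?\<phi> = "residue_part ?q \<alpha> l :: ('n, 'a) mpoly \<Rightarrow> _"
  have l_add: "l (x + y) = l x + l y" and l_scale: "l (c ^ ?q * x) = c * l x" for x y c
    using l by (auto simp: frobenius_linear_def)
  have l0: "l 0 = 0" using l_add[of 0 0] by simp
  have q: "?q > 0" using p by (simp add: prime_gt_0_nat)
  have add: "?\<phi> (x + y) = ?\<phi> x + ?\<phi> y" for x y
    by (rule residue_part_add[OF l_add])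
  have "?\<phi> (r ^ ?q * x) = r * ?\<phi> x" for r x
  proof (induction r rule: mpoly_induct)
    case (single k c)
    show ?case
    proof (induction x rule: mpoly_induct)
      case (single m d)
      let ?k = "Poly_Mapping.map ((*) ?q) k + m"
      have "Poly_Mapping.map (\<lambda>x. x mod ?q) ?k = Poly_Mapping.map (\<lambda>x. x mod ?q) m"
        by (rule poly_mapping_eqI) (simp add: lookup_map_0 lookup_add)
      moreover have "Poly_Mapping.map (\<lambda>x. x div ?q) ?k = k + Poly_Mapping.map (\<lambda>x. x div ?q) m"
        by (rule poly_mapping_eqI) (use q in \<open>simp add: lookup_map_0 lookup_add\<close>)
      ultimately show ?case
        by (simp add: single_power mult_single residue_part_single l0 l_scale)
    next
      case (add f g)
      then show ?case by (simp add: distrib_left \<open>\<And>x y. ?\<phi> (x + y) = ?\<phi> x + ?\<phi> y\<close>)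
    qed
  next
    case (add f g)
    have "(f + g) ^ ?q = f ^ ?q + g ^ ?q"
      using p freshmans_dream'[of ?q e f g] by (simp add: CHAR_mpoly)
    then show ?case
      using add by (simp add: distrib_right \<open>\<And>x y. ?\<phi> (x + y) = ?\<phi> x + ?\<phi> y\<close>)
  qed
  then show ?thesis using add by (simp add: frobenius_linear_def CHAR_mpoly)
qed

text \<open>The coordinates of a field with respect to a basis over its subfield of \<open>p\<^sup>e\<close>-th powers,
  with \<open>c\<close> standing for the scalar \<open>c\<^bsup>p^e\<^esup>\<close>.\<close>

lemma field_frobenius_coordinates:
  assumes p: "prime CHAR('a::field)"
  shows "\<exists>l :: 'a \<Rightarrow> 'a \<Rightarrow> 'a. l 1 1 = 1 \<and> (\<forall>b. frobenius_linear e (l b)) \<and>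
    (\<forall>x. finite {b. l b x \<noteq> 0}) \<and> (\<forall>x. (\<Sum>b | l b x \<noteq> 0. l b x ^ (CHAR('a) ^ e) * b) = x)"
proof -
  let ?q = "CHAR('a) ^ e"
  interpret V: vector_space "\<lambda>c x :: 'a. c ^ ?q * x"
  proof
    fix a b x y :: 'a
    show "a ^ ?q * (x + y) = a ^ ?q * x + a ^ ?q * y" by (rule distrib_left)
    show "(a + b) ^ ?q * x = a ^ ?q * x + b ^ ?q * x"
      unfolding freshmans_dream'[OF p refl] by (rule distrib_right)
    show "a ^ ?q * (b ^ ?q * x) = (a * b) ^ ?q * x" by (simp only: power_mult_distrib mult.assoc)
    show "1 ^ ?q * x = x" by simp
  qed
  \<comment> \<open>Since the basis contains 1, the coordinate at 1 sends 1 to 1; this is the source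
    of the splitting of Frobenius used below.\<close>
  define B where "B = V.extend_basis {1}"
  have ind1: "V.independent {1}" by (simp add: V.dependent_single)
  have B: "1 \<in> B" "V.independent B" "V.span B = UNIV"
    using V.extend_basis_superset[OF ind1] V.independent_extend_basis[OF ind1]
      V.span_extend_basis[OF ind1] by (auto simp: B_def)
  show ?thesis
  proof (intro exI[of _ "\<lambda>b x. V.representation B x b"] conjI allI)
    show "V.representation B 1 1 = 1" using V.representation_basis[OF B(2,1)] by simp
    show "frobenius_linear e (\<lambda>x. V.representation B x b)" for b
      using B by (auto simp: frobenius_linear_def V.representation_add V.representation_scale)
    show "finite {b. V.representation B x b \<noteq> 0}" for x by (rule V.finite_representation)
    show "(\<Sum>b | V.representation B x b \<noteq> 0. V.representation B x b ^ ?q * b) = x" for x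
      using V.sum_nonzero_representation_eq[of B x] B by simp
  qed
qed

text \<open>The polynomial ring is free over its q-th powers on the elements b x^\<alpha>, so g is
  the sum of the q-th powers of its coordinates times these elements. The coordinate maps are
  themselves linear in the required sense; if they send g into I, the sum exhibits g in
  I^[q].\<close>

lemma mem_frobenius_power_mpoly:
  fixes g :: "('n, 'a::field) mpoly"
  assumes p: "prime CHAR('a)" and I: "ring_ideal I"
  shows "g \<in> frobenius_power I e \<longleftrightarrow> (\<forall>\<phi>. frobenius_linear e \<phi> \<longrightarrow> \<phi> g \<in> I)"
proof (intro iffI allI impI)
  show "\<phi> g \<in> I" if "g \<in> frobenius_power I e" "frobenius_linear e \<phi>" for \<phi>
    using frobenius_linear_frobenius_power[OF I that(2,1)] .
next
  assume *: "\<forall>\<phi>. frobenius_linear e \<phi> \<longrightarrow> \<phi> g \<in> I"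
  let ?q = "CHAR('a) ^ e"
  obtain l :: "'a \<Rightarrow> 'a \<Rightarrow> 'a" where l: "l 1 1 = 1 \<and> (\<forall>b. frobenius_linear e (l b)) \<and>
    (\<forall>x. finite {b. l b x \<noteq> 0}) \<and> (\<forall>x. (\<Sum>b | l b x \<noteq> 0. l b x ^ ?q * b) = x)"
    using field_frobenius_coordinates[OF p, of e] ..
  have l3: "frobenius_linear e (l b)" and l4: "finite {b. l b x \<noteq> 0}"
    and l5: "(\<Sum>b | l b x \<noteq> 0. l b x ^ ?q * b) = x" for b x
    using l by blast+
  have l_add: "l b (x + y) = l b x + l b y" for b x y
    using l3[of b] unfolding frobenius_linear_def by blast
  have l0: "l b 0 = 0" for b using l_add[of b 0 0] by (simp only: add_0_left add_cancel_right_right)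
  have q: "?q > 0" using p by (simp add: prime_gt_0_nat)
  let ?mod = "Poly_Mapping.map (\<lambda>x. x mod ?q) :: ('n \<Rightarrow>\<^sub>0 nat) \<Rightarrow> _"
  let ?div = "Poly_Mapping.map (\<lambda>x. x div ?q) :: ('n \<Rightarrow>\<^sub>0 nat) \<Rightarrow> _"
  \<comment> \<open>The field basis may be infinite, so the expansion \<open>T\<close> runs only
    over the residues and field coordinates that occur in \<open>g\<close>. It is additive and
    reproduces the monomials of \<open>g\<close>, which suffices.\<close>
  define E where "E = ?mod ` Poly_Mapping.keys g"
  define C where "C = (\<Union>k\<in>Poly_Mapping.keys g. {b. l b (Poly_Mapping.lookup g k) \<noteq> 0})"
  have fin: "finite E" "finite C" using l4 by (auto simp: E_def C_def)
  define T where "T f = (\<Sum>\<alpha>\<in>E. \<Sum>b\<in>C. residue_part ?q \<alpha> (l b) f ^ ?q * Poly_Mapping.single \<alpha> b)"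
    for f :: "('n, 'a) mpoly"
  have frob: "(x + y) ^ ?q = x ^ ?q + y ^ ?q" for x y :: "('n, 'a) mpoly"
    using p freshmans_dream'[of ?q e x y] by (simp add: CHAR_mpoly)
  have T_add: "T (x + y) = T x + T y" for x y
    by (simp add: T_def residue_part_add[OF l_add] frob distrib_right sum.distrib)
  have T_0: "T 0 = 0" using T_add[of 0 0] by simp
  have T_single: "T (Poly_Mapping.single k c) = Poly_Mapping.single k c"
    if k: "?mod k \<in> E" and c: "{b. l b c \<noteq> 0} \<subseteq> C" for k c
  proof -
    have k_eq: "Poly_Mapping.map ((*) ?q) (?div k) + ?mod k = k"
      by (rule poly_mapping_eqI) (simp add: lookup_map_0 lookup_add)
    have "T (Poly_Mapping.single k c) = (\<Sum>\<alpha>\<in>E. if ?mod k = \<alpha> then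
        (\<Sum>b\<in>C. Poly_Mapping.single (?div k) (l b c) ^ ?q * Poly_Mapping.single \<alpha> b) else 0)"
      unfolding T_def using q by (intro sum.cong) (auto simp: residue_part_single l0 zero_power)
    also have "\<dots> = (\<Sum>b\<in>C. Poly_Mapping.single (?div k) (l b c) ^ ?q * Poly_Mapping.single (?mod k) b)"
      using k fin by simp
    also have "\<dots> = (\<Sum>b\<in>C. Poly_Mapping.single k (l b c ^ ?q * b))"
      by (simp add: single_power mult_single k_eq)
    also have "\<dots> = (\<Sum>b | l b c \<noteq> 0. Poly_Mapping.single k (l b c ^ ?q * b))"
      using c fin q by (intro sum.mono_neutral_right) (auto simp: zero_power)
    also have "\<dots> = Poly_Mapping.single k (\<Sum>b | l b c \<noteq> 0. l b c ^ ?q * b)"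
      by (rule sym, rule poly_mapping_eqI) (auto simp: lookup_sum lookup_single when_def)
    finally show ?thesis by (simp add: l5)
  qed
  have "T (\<Sum>k\<in>A. Poly_Mapping.single k (Poly_Mapping.lookup g k)) =
      (\<Sum>k\<in>A. Poly_Mapping.single k (Poly_Mapping.lookup g k))"
    if "finite A" "A \<subseteq> Poly_Mapping.keys g" for A
    using that
  proof induction
    case (insert k A)
    have "T (Poly_Mapping.single k (Poly_Mapping.lookup g k)) = Poly_Mapping.single k (Poly_Mapping.lookup g k)"
      using insert.prems by (intro T_single) (auto simp: E_def C_def)
    then show ?case using insert by (simp add: T_add)
  qed (simp add: T_0)
  from this[OF finite_keys order_refl] have "T g = g"
    unfolding mpoly_eq_sum_single[of g, symmetric] .
  moreover have "T g \<in> frobenius_power I e"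
    unfolding T_def
  proof (intro self_module.subspace_sum ring_ideal_frobenius_power ring_ideal_mult_right)
    fix \<alpha> b
    have "residue_part ?q \<alpha> (l b) g \<in> I"
      by (rule *[rule_format, OF frobenius_linear_residue_part[OF p l3]])
    then show "residue_part ?q \<alpha> (l b) g ^ ?q \<in> frobenius_power I e"
      using power_in_frobenius_power[where I = I and e = e] unfolding CHAR_mpoly by blast
  qed
  ultimately show "g \<in> frobenius_power I e" by simp
qed

section \<open>Consequences of freeness: splitting, colons, saturation\<close>

lemma frobenius_splitting_mpoly:
  assumes p: "prime CHAR('a::field)"
  obtains \<phi> :: "('n, 'a::field) mpoly \<Rightarrow> ('n, 'a) mpoly" where "frobenius_linear e \<phi>" "\<phi> 1 = 1"
proof -
  obtain l :: "'a \<Rightarrow> 'a \<Rightarrow> 'a" where l: "l 1 1 = 1" and l3: "\<And>b. frobenius_linear e (l b)"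
    using field_frobenius_coordinates[OF p, of e] by blast
  have "l 1 (0 + 0) = l 1 0 + l 1 0" using l3 by (metis frobenius_linear_def)
  then have l0: "l 1 0 = 0" by (simp only: add_0_left add_cancel_right_right)
  have "Poly_Mapping.map f (0 :: 'n \<Rightarrow>\<^sub>0 nat) = 0" for f :: "nat \<Rightarrow> nat"
    by (rule poly_mapping_eqI) (simp add: map.rep_eq)
  then have "residue_part (CHAR('a) ^ e) 0 (l 1) (1 :: ('n, 'a) mpoly) = 1"
    using residue_part_single[of "l 1" "CHAR('a) ^ e" "0 :: 'n \<Rightarrow>\<^sub>0 nat" 0 1, OF l0] l by simp
  then show ?thesis using that frobenius_linear_residue_part[OF p l3] by blast
qed

text \<open>A splitting \<phi> with \<phi>(1) = 1 sends x^q back to x and I^[q] into I.\<close>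

lemma power_mem_frobenius_power_mpoly_iff:
  fixes x :: "('n, 'a::field) mpoly"
  assumes p: "prime CHAR('a)" and I: "ring_ideal I"
  shows "x ^ (CHAR('a) ^ e) \<in> frobenius_power I e \<longleftrightarrow> x \<in> I"
proof
  assume x: "x ^ (CHAR('a) ^ e) \<in> frobenius_power I e"
  obtain \<phi> :: "('n, 'a) mpoly \<Rightarrow> ('n, 'a) mpoly" where \<phi>: "frobenius_linear e \<phi>" "\<phi> 1 = 1"
    using frobenius_splitting_mpoly[OF p] .
  have "\<phi> (x ^ (CHAR('a) ^ e) * 1) = x * \<phi> 1"
    using \<phi>(1) unfolding frobenius_linear_def CHAR_mpoly by blast
  then show "x \<in> I" using frobenius_linear_frobenius_power[OF I \<phi>(1) x] \<phi>(2) by simp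
qed (use power_in_frobenius_power[where I = I and e = e and x = x] in \<open>simp add: CHAR_mpoly\<close>)

text \<open>As \<phi>(c^q x) = c \<phi>(x), both sides say that c \<phi>(x) lies in I for every
  linear \<phi>. This is the flatness of Frobenius.\<close>

lemma frobenius_power_colon_mpoly:
  fixes c :: "('n, 'a::field) mpoly"
  assumes p: "prime CHAR('a)" and I: "ring_ideal I"
  shows "c ^ (CHAR('a) ^ e) * x \<in> frobenius_power I e \<longleftrightarrow> x \<in> frobenius_power {z. c * z \<in> I} e"
proof -
  have "\<phi> (c ^ (CHAR('a) ^ e) * x) = c * \<phi> x" if "frobenius_linear e \<phi>" for \<phi>
    using that unfolding frobenius_linear_def CHAR_mpoly by blast
  then show ?thesis
    by (auto simp: mem_frobenius_power_mpoly[OF p] I ring_ideal_colon)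
qed

text \<open>Multiplying further, up to u^q * x, makes the colon lemma applicable, and (I : u) is
  contained in I.\<close>

lemma frobenius_power_saturated_mpoly:
  fixes u :: "('n, 'a::field) mpoly"
  assumes p: "prime CHAR('a)" and I: "ring_ideal I"
    and sat: "\<And>x. u * x \<in> I \<Longrightarrow> x \<in> I" and x: "u * x \<in> frobenius_power I e"
  shows "x \<in> frobenius_power I e"
proof -
  have "CHAR('a) ^ e > 0" using p by (simp add: prime_gt_0_nat)
  then have "u ^ (CHAR('a) ^ e) * x = u ^ (CHAR('a) ^ e - 1) * (u * x)"
    by (simp add: mult.assoc[symmetric] flip: power_Suc2)
  then have "u ^ (CHAR('a) ^ e) * x \<in> frobenius_power I e"
    using ring_ideal_mult_left[OF ring_ideal_frobenius_power x] by metis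
  then have "x \<in> frobenius_power {z. u * z \<in> I} e"
    by (simp add: frobenius_power_colon_mpoly[OF p I])
  then show ?thesis using frobenius_power_mono[of "{z. u * z \<in> I}" I e] sat by blast
qed

section \<open>Frobenius powers in the localization\<close>

lemma to_local_add: "to_local (f + g) = to_local f + to_local g"
  by (simp add: fract_of_inject[symmetric] fract_of_to_local plus_local_ring.rep_eq)

lemma to_local_mult: "to_local (f * g) = to_local f * to_local g"
  by (simp add: fract_of_inject[symmetric] fract_of_to_local times_local_ring.rep_eq)

lemma to_local_0 [simp]: "to_local 0 = 0"
  by (simp add: fract_of_inject[symmetric] fract_of_to_local zero_local_ring.rep_eq Zero_fract_def)

lemma to_local_1 [simp]: "to_local 1 = 1"
  by (simp add: fract_of_inject[symmetric] fract_of_to_local one_local_ring.rep_eq One_fract_def)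

lemma to_local_power: "to_local (f ^ m) = to_local f ^ m"
  by (induction m) (simp_all add: to_local_mult)

lemma to_local_eq_iff: "to_local f = to_local g \<longleftrightarrow> f = g"
  by (simp add: fract_of_inject[symmetric] fract_of_to_local eq_fract)

lemma local_ring_fraction:
  fixes x :: "('n::{finite,linorder}, 'a::field) local_ring"
  obtains a s where "s \<notin> origin_ideal" "to_local s * x = to_local a"
proof -
  obtain a s where s: "s \<notin> origin_ideal" "fract_of x = Fract a s"
    using fract_of[of x] unfolding origin_fractions_def by blast
  then have "s \<noteq> 0" using origin_ideal_complement(2) by metis
  then have "to_local s * x = to_local a"
    using s(2) by (simp add: fract_of_inject[symmetric] fract_of_to_local times_local_ring.rep_eq eq_fract)
  then show ?thesis using that s(1) by blast
qed

lemma to_local_unit: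
  assumes "s \<notin> origin_ideal"
  obtains v where "v * to_local s = 1"
proof -
  have s0: "s \<noteq> 0" using assms origin_ideal_complement(2) by metis
  have in_fr: "Fract 1 s \<in> origin_fractions" using assms unfolding origin_fractions_def by blast
  have "Abs_local (Fract 1 s) * to_local s = 1"
    using s0 by (simp add: fract_of_inject[symmetric] fract_of_to_local times_local_ring.rep_eq
        one_local_ring.rep_eq Abs_local_inverse[OF in_fr] eq_fract One_fract_def)
  then show ?thesis by (rule that)
qed

lemma ring_ideal_contraction:
  assumes "ring_ideal J"
  shows "ring_ideal (to_local -` J)"
  by (rule self_module.subspaceI)
    (use assms in \<open>auto simp: to_local_add to_local_mult self_module.subspace_0
      self_module.subspace_add ring_ideal_mult_left\<close>)

lemma contraction_saturated:
  assumes J: "ring_ideal J" and s: "s \<notin> origin_ideal" and x: "s * x \<in> to_local -` J"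
  shows "x \<in> to_local -` J"
proof -
  obtain v where v: "v * to_local s = 1" using to_local_unit[OF s] .
  have "v * to_local (s * x) \<in> J" using J x by (simp add: ring_ideal_mult_left)
  moreover have "v * to_local (s * x) = to_local x"
    using v by (simp add: to_local_mult mult.assoc[symmetric])
  ultimately show ?thesis by simp
qed

lemma origin_ideal_power_complement:
  "s \<notin> origin_ideal \<Longrightarrow> s ^ m \<notin> (origin_ideal :: ('n, 'a::idom) mpoly set)"
  by (induction m) (simp_all add: origin_ideal_complement)

text \<open>Clearing denominators in an expression for g as an element of J^[q] puts s * g into the
  Frobenius power of the contraction, with s outside the maximal ideal. The contraction is
  saturated, hence so is its Frobenius power, and s cancels.\<close>

lemma frobenius_power_local_iff:
  fixes g :: "('n::{finite,linorder}, 'a::field) mpoly"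
  assumes p: "prime CHAR('a)" and J: "ring_ideal J"
  shows "to_local g \<in> frobenius_power J e \<longleftrightarrow> g \<in> frobenius_power (to_local -` J) e"
proof
  let ?q = "CHAR('a) ^ e"
  let ?I = "frobenius_power (to_local -` J) e"
  assume "to_local g \<in> frobenius_power J e"
  then have "\<exists>s r. s \<notin> origin_ideal \<and> r \<in> ?I \<and> to_local s * to_local g = to_local r"
    unfolding frobenius_power_def[of J] CHAR_local_ring
  proof (induction rule: self_module.span_induct_alt)
    case base
    show ?case
      using self_module.subspace_0[OF ring_ideal_frobenius_power, of "to_local -` J" e]
      by (intro exI[of _ 1] exI[of _ 0]) (auto simp: origin_ideal_complement)
  next
    case (step c x y)
    obtain z where z: "z \<in> J" "x = z ^ ?q" using step by auto
    obtain s r where sr: "s \<notin> origin_ideal" "r \<in> ?I" "to_local s * y = to_local r" using step by blast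
    obtain a t where at: "t \<notin> origin_ideal" "to_local t * z = to_local a"
      using local_ring_fraction .
    obtain b v where bv: "v \<notin> origin_ideal" "to_local v * c = to_local b"
      using local_ring_fraction .
    have "to_local a \<in> J" using at z(1) ring_ideal_mult_left[OF J] by metis
    then have a: "a ^ ?q \<in> ?I"
      using power_in_frobenius_power[of a "to_local -` J" e] by (simp add: CHAR_mpoly)
    \<comment> \<open>The denominator t of z is raised to the power q because the generator is z^q
      and has to become a^q with a in the contraction.\<close>
    have "to_local (v * t ^ ?q * s) * (c * x + y) =
        (to_local v * c) * (to_local t * z) ^ ?q * to_local s + to_local (v * t ^ ?q) * (to_local s * y)"
      by (simp add: z(2) to_local_mult to_local_power power_mult_distrib algebra_simps)
    also have "\<dots> = to_local (b * s * a ^ ?q + v * t ^ ?q * r)"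
      unfolding sr at bv by (simp add: to_local_mult to_local_power to_local_add mult_ac)
    finally have "to_local (v * t ^ ?q * s) * (c * x + y) = to_local (b * s * a ^ ?q + v * t ^ ?q * r)" .
    moreover have "v * t ^ ?q * s \<notin> origin_ideal"
      using sr at bv by (simp add: origin_ideal_complement origin_ideal_power_complement)
    moreover have "b * s * a ^ ?q + v * t ^ ?q * r \<in> ?I"
      by (intro self_module.subspace_add ring_ideal_mult_left ring_ideal_frobenius_power a sr)
    ultimately show ?case by blast
  qed
  then obtain s r where sr: "s \<notin> origin_ideal" "r \<in> ?I" "to_local s * to_local g = to_local r"
    by blast
  then have "s * g \<in> ?I" by (metis to_local_eq_iff to_local_mult)
  then show "g \<in> ?I"
    using frobenius_power_saturated_mpoly[OF p ring_ideal_contraction[OF J]]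
      contraction_saturated[OF J sr(1)] by blast
next
  have pow: "to_local (x ^ (CHAR(('n, 'a) mpoly) ^ e)) \<in> frobenius_power J e" if "to_local x \<in> J"
    for x :: "('n, 'a) mpoly"
    using power_in_frobenius_power[OF that, of e] by (simp only: to_local_power CHAR_mpoly CHAR_local_ring)
  have "frobenius_power (to_local -` J) e \<subseteq> to_local -` frobenius_power J e"
    unfolding frobenius_power_def[of "to_local -` J"]
    by (intro ideal_gen_minimal ring_ideal_contraction ring_ideal_frobenius_power)
      (use pow in auto)
  then show "g \<in> frobenius_power (to_local -` J) e \<Longrightarrow> to_local g \<in> frobenius_power J e" by blast
qed

section \<open>Test ideals in the localization\<close>

text \<open>An ideal J satisfies r \<in> J^[q] iff it contains all \<phi>(r), so the ideal generated
  by these is least; in particular the \<open>LEAST\<close> is attained.\<close>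

lemma frobenius_root_local_eq:
  fixes r :: "('n::{finite,linorder}, 'a::field) mpoly"
  assumes p: "prime CHAR('a)"
  shows "frobenius_root (to_local r) e = ideal_gen {to_local (\<phi> r) | \<phi>. frobenius_linear e \<phi>}"
    (is "_ = ideal_gen ?X")
  unfolding frobenius_root_def
proof (rule Least_equality)
  have *: "to_local r \<in> frobenius_power J e \<longleftrightarrow> ?X \<subseteq> J" if "ring_ideal J" for J
    using frobenius_power_local_iff[OF p that] mem_frobenius_power_mpoly[OF p ring_ideal_contraction[OF that]]
    by auto
  show "ring_ideal (ideal_gen ?X) \<and> to_local r \<in> frobenius_power (ideal_gen ?X) e"
    using *[of "ideal_gen ?X"] self_module.span_superset[of ?X] by auto
  show "ideal_gen ?X \<le> J" if "ring_ideal J \<and> to_local r \<in> frobenius_power J e" for J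
    using that * ideal_gen_minimal by blast
qed

lemma ring_ideal_frobenius_root_local:
  fixes r :: "('n::{finite,linorder}, 'a::field) mpoly"
  assumes "prime CHAR('a)"
  shows "ring_ideal (frobenius_root (to_local r) e)"
  by (simp add: frobenius_root_local_eq[OF assms])

text \<open>Universal property of the root. With J itself a root, it turns inclusions between roots
  into memberships in Frobenius powers of polynomial ideals.\<close>

lemma frobenius_root_local_subset_iff:
  fixes r :: "('n::{finite,linorder}, 'a::field) mpoly"
  assumes p: "prime CHAR('a)" and J: "ring_ideal J"
  shows "frobenius_root (to_local r) e \<subseteq> J \<longleftrightarrow> r \<in> frobenius_power (to_local -` J) e"
proof -
  let ?X = "{to_local (\<phi> r) | \<phi>. frobenius_linear e \<phi>}"
  have "ideal_gen ?X \<subseteq> J \<longleftrightarrow> ?X \<subseteq> J"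
    using order.trans[OF self_module.span_superset] ideal_gen_minimal[OF _ J] by (rule iffI)
  also have "\<dots> \<longleftrightarrow> r \<in> frobenius_power (to_local -` J) e"
    unfolding mem_frobenius_power_mpoly[OF p ring_ideal_contraction[OF J]] by auto
  finally show ?thesis unfolding frobenius_root_local_eq[OF p] .
qed

lemma frobenius_root_local_antimono:
  fixes g :: "('n::{finite,linorder}, 'a::field) mpoly"
  assumes p: "prime CHAR('a)" and ab: "a \<le> b"
  shows "frobenius_root (to_local g ^ b) e \<subseteq> frobenius_root (to_local g ^ a) e"
proof -
  let ?J = "frobenius_root (to_local (g ^ a)) e"
  note J = ring_ideal_frobenius_root_local[OF p, of "g ^ a" e]
  have "g ^ a \<in> frobenius_power (to_local -` ?J) e"
    using frobenius_root_local_subset_iff[OF p J] by blast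
  then have "g ^ (b - a) * g ^ a \<in> frobenius_power (to_local -` ?J) e"
    by (intro ring_ideal_mult_left) auto
  then show ?thesis
    using frobenius_root_local_subset_iff[OF p J, of "g ^ b" e] ab
    by (simp add: to_local_power flip: power_add)
qed

text \<open>If g^p lies in (J^[p^e])^[p], the p-th power can be removed on both sides. This makes
  the union defining a test ideal ascend.\<close>

lemma frobenius_root_local_Suc:
  fixes g :: "('n::{finite,linorder}, 'a::field) mpoly"
  assumes p: "prime CHAR('a)"
  shows "frobenius_root (to_local g) e \<subseteq> frobenius_root (to_local g ^ CHAR('a)) (Suc e)"
proof -
  let ?J = "frobenius_root (to_local (g ^ CHAR('a))) (Suc e)"
  note J = ring_ideal_frobenius_root_local[OF p, of "g ^ CHAR('a)" "Suc e"]
  have "g ^ CHAR('a) \<in> frobenius_power (to_local -` ?J) (e + 1)"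
    using frobenius_root_local_subset_iff[OF p J, of "g ^ CHAR('a)" "Suc e"] by simp
  then have "g ^ (CHAR('a) ^ 1) \<in> frobenius_power (frobenius_power (to_local -` ?J) e) 1"
    using frobenius_power_frobenius_power[where 'a = "('n, 'a) mpoly"] p by (simp add: CHAR_mpoly)
  then have "g \<in> frobenius_power (to_local -` ?J) e"
    using power_mem_frobenius_power_mpoly_iff[OF p ring_ideal_frobenius_power] by blast
  then show ?thesis
    using frobenius_root_local_subset_iff[OF p J] by (simp add: to_local_power)
qed

lemma nat_ceiling_mult_le:
  fixes t :: real
  shows "nat \<lceil>real (p * q) * t\<rceil> \<le> p * nat \<lceil>real q * t\<rceil>"
proof -
  have "real q * t \<le> real (nat \<lceil>real q * t\<rceil>)" by linarith
  then have "real p * (real q * t) \<le> real p * real (nat \<lceil>real q * t\<rceil>)"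
    by (intro mult_left_mono) auto
  then have "real (p * q) * t \<le> real (p * nat \<lceil>real q * t\<rceil>)" by (simp add: mult_ac)
  then show ?thesis by linarith
qed

lemma test_ideal_local:
  "test_ideal (to_local g :: ('n::{finite,linorder}, 'a::field) local_ring) t =
     (\<Union>e\<in>{1..}. frobenius_root (to_local g ^ nat \<lceil>real (CHAR('a) ^ e) * t\<rceil>) e)"
  by (simp add: test_ideal_def CHAR_local_ring)

lemma test_ideal_local_ascending:
  fixes g :: "('n::{finite,linorder}, 'a::field) mpoly"
  assumes p: "prime CHAR('a)"
  shows "mono (\<lambda>e. frobenius_root (to_local g ^ nat \<lceil>real (CHAR('a) ^ e) * t\<rceil>) e)"
proof (rule mono_iff_le_Suc[THEN iffD2], rule allI)
  fix e
  let ?a = "nat \<lceil>real (CHAR('a) ^ e) * t\<rceil>"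
  have "frobenius_root (to_local (g ^ ?a)) e \<subseteq> frobenius_root (to_local (g ^ ?a) ^ CHAR('a)) (Suc e)"
    by (rule frobenius_root_local_Suc[OF p])
  also have "\<dots> = frobenius_root (to_local g ^ (CHAR('a) * ?a)) (Suc e)"
    by (simp add: to_local_power mult.commute flip: power_mult)
  also have "\<dots> \<subseteq> frobenius_root (to_local g ^ nat \<lceil>real (CHAR('a) ^ Suc e) * t\<rceil>) (Suc e)"
    using nat_ceiling_mult_le[of "CHAR('a)" "CHAR('a) ^ e" t]
    by (intro frobenius_root_local_antimono[OF p]) simp
  finally show "frobenius_root (to_local g ^ ?a) e \<subseteq>
      frobenius_root (to_local g ^ nat \<lceil>real (CHAR('a) ^ Suc e) * t\<rceil>) (Suc e)"
    by (simp add: to_local_power)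
qed

text \<open>An ascending union can start at any level; the comparison of roots below needs q so
  large that the ceiling of q * t is less than q.\<close>

lemma test_ideal_local_tail:
  fixes g :: "('n::{finite,linorder}, 'a::field) mpoly"
  assumes p: "prime CHAR('a)"
  shows "test_ideal (to_local g) t =
     (\<Union>e\<in>{m..}. frobenius_root (to_local g ^ nat \<lceil>real (CHAR('a) ^ e) * t\<rceil>) e)" (is "_ = (\<Union>e\<in>_. ?r e)")
proof -
  have "(\<Union>e\<in>{k..}. ?r e) \<subseteq> (\<Union>e\<in>{m..}. ?r e)" for k m
  proof -
    have "?r e \<subseteq> ?r (max e m)" for e
      using monoD[OF test_ideal_local_ascending[OF p], of e "max e m"] by simp
    then show ?thesis by fastforce
  qed
  then show ?thesis unfolding test_ideal_local by blast
qed

lemma test_ideal_local_antimono: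
  fixes g :: "('n::{finite,linorder}, 'a::field) mpoly"
  assumes p: "prime CHAR('a)" and st: "s \<le> t"
  shows "test_ideal (to_local g) t \<subseteq> test_ideal (to_local g) s"
proof -
  have "nat \<lceil>real (CHAR('a) ^ e) * s\<rceil> \<le> nat \<lceil>real (CHAR('a) ^ e) * t\<rceil>" for e
    using st by (intro nat_mono ceiling_mono mult_left_mono) auto
  then show ?thesis
    unfolding test_ideal_local by (intro UN_mono order_refl frobenius_root_local_antimono[OF p])
qed

text \<open>Since g^q lies in (g)^[q], the root of g^q is contained in (g), and for t \<ge> 1 the
  exponents are at least q.\<close>

lemma test_ideal_local_subset:
  fixes g :: "('n::{finite,linorder}, 'a::field) mpoly"
  assumes p: "prime CHAR('a)" and t: "1 \<le> t"
  shows "test_ideal (to_local g) t \<subseteq> ideal_gen {to_local g}"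
  unfolding test_ideal_local
proof (intro UN_least)
  fix e
  let ?q = "CHAR('a) ^ e" and ?J = "ideal_gen {to_local g}"
  have "g \<in> to_local -` ?J" by (simp add: self_module.span_base)
  then have "g ^ ?q \<in> frobenius_power (to_local -` ?J) e"
    using power_in_frobenius_power[of g "to_local -` ?J" e] by (simp only: CHAR_mpoly)
  then have "frobenius_root (to_local g ^ ?q) e \<subseteq> ?J"
    using frobenius_root_local_subset_iff[OF p ring_ideal_ideal_gen, of "g ^ ?q"] by (simp add: to_local_power)
  moreover have "real ?q * 1 \<le> real ?q * t" using t by (intro mult_left_mono) auto
  then have "?q \<le> nat \<lceil>real ?q * t\<rceil>" by linarith
  ultimately show "frobenius_root (to_local g ^ nat \<lceil>real ?q * t\<rceil>) e \<subseteq> ?J"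
    using order.trans[OF frobenius_root_local_antimono[OF p]] by blast
qed

section \<open>Powers of ideals\<close>

lemma ring_ideal_ideal_prod [simp, intro]: "ring_ideal (ideal_prod I J)"
  by (simp add: ideal_prod_def)

lemma ring_ideal_ideal_power [simp, intro]: "ring_ideal (ideal_power I k)"
  by (cases k) auto

lemma ideal_prod_subset:
  assumes "ring_ideal K" "\<And>a b. a \<in> I \<Longrightarrow> b \<in> J \<Longrightarrow> a * b \<in> K"
  shows "ideal_prod I J \<subseteq> K"
  unfolding ideal_prod_def using assms by (intro ideal_gen_minimal) auto

lemma ideal_prodI: "a \<in> I \<Longrightarrow> b \<in> J \<Longrightarrow> a * b \<in> ideal_prod I J"
  unfolding ideal_prod_def by (intro self_module.span_base) auto

lemma ideal_power_mult:
  assumes "x \<in> ideal_power I k" "y \<in> ideal_power I m"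
  shows "x * y \<in> ideal_power I (k + m)"
  using assms
proof (induction k arbitrary: x)
  case 0
  then show ?case by (simp add: ring_ideal_mult_left)
next
  case (Suc k)
  have "ideal_prod I (ideal_power I k) \<subseteq> {z. y * z \<in> ideal_power I (Suc k + m)}"
  proof (intro ideal_prod_subset ring_ideal_colon ring_ideal_ideal_power CollectI)
    fix a b assume "a \<in> I" "b \<in> ideal_power I k"
    then have "a * (b * y) \<in> ideal_power I (Suc (k + m))"
      using Suc.IH Suc.prems(2) by (simp add: ideal_prodI)
    then show "y * (a * b) \<in> ideal_power I (Suc k + m)" by (simp only: add_Suc mult_ac)
  qed
  then show ?case using Suc.prems(1) by (auto simp: mult.commute)
qed

lemma ideal_power_Suc_subset: "ideal_power I (Suc k) \<subseteq> ideal_power I k"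
  unfolding ideal_power.simps by (intro ideal_prod_subset) (auto intro: ring_ideal_mult_left)

lemma ideal_power_antimono: "k \<le> m \<Longrightarrow> ideal_power I m \<subseteq> ideal_power I k"
  by (rule lift_Suc_antimono_le[of "ideal_power I", OF ideal_power_Suc_subset])

lemma ideal_power_mono:
  assumes "I \<subseteq> J"
  shows "ideal_power I k \<subseteq> ideal_power J k"
proof (induction k)
  case (Suc k)
  have "ideal_prod I (ideal_power I k) \<subseteq> ideal_prod J (ideal_power J k)"
    using assms Suc.IH
    by (intro ideal_prod_subset) (auto intro!: ideal_prodI)
  then show ?case by simp
qed simp

lemma ideal_power_power: "x \<in> ideal_power I k \<Longrightarrow> x ^ m \<in> ideal_power I (k * m)"
  by (induction m) (simp_all add: ideal_power_mult)

lemma ideal_power_ideal_power: "ideal_power I (k * m) \<subseteq> ideal_power (ideal_power I k) m"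
proof (induction m)
  case (Suc m)
  have "ideal_power I (a + b) \<subseteq> ideal_prod (ideal_power I a) (ideal_power I b)" for a b
  proof (induction a)
    case 0
    show ?case using ideal_prodI[of 1 "UNIV" _ "ideal_power I b"] by auto
  next
    case (Suc a)
    have "ideal_prod I (ideal_power I (a + b)) \<subseteq> ideal_prod (ideal_power I (Suc a)) (ideal_power I b)"
    proof (intro ideal_prod_subset ring_ideal_ideal_prod)
      fix x y assume x: "x \<in> I" and y: "y \<in> ideal_power I (a + b)"
      have "ideal_prod (ideal_power I a) (ideal_power I b)
          \<subseteq> {y. x * y \<in> ideal_prod (ideal_power I (Suc a)) (ideal_power I b)}"
        by (intro ideal_prod_subset ring_ideal_colon)
          (auto simp: mult.assoc[symmetric] intro!: ideal_prodI x)
      then show "x * y \<in> ideal_prod (ideal_power I (Suc a)) (ideal_power I b)"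
        using Suc.IH y by blast
    qed
    then show ?case by simp
  qed
  then have "ideal_power I (k + k * m) \<subseteq> ideal_prod (ideal_power I k) (ideal_power I (k * m))" .
  also have "\<dots> \<subseteq> ideal_prod (ideal_power I k) (ideal_power (ideal_power I k) m)"
    using Suc.IH by (intro ideal_prod_subset) (auto intro!: ideal_prodI)
  finally show ?case by simp
qed simp

section \<open>Derivatives and the Jacobian ideal\<close>

lemma partial_deriv_single:
  "partial_deriv i (Poly_Mapping.single k c) =
     Poly_Mapping.single (k - Poly_Mapping.single i 1) (of_nat (Poly_Mapping.lookup k i) * c)"
  by (cases "c = 0") (simp_all add: partial_deriv_def)

lemma partial_deriv_add: "partial_deriv i (f + g) = partial_deriv i f + partial_deriv i g"
proof -
  let ?A = "Poly_Mapping.keys f \<union> Poly_Mapping.keys g"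
  have *: "partial_deriv i h = (\<Sum>k\<in>?A. Poly_Mapping.single (k - Poly_Mapping.single i 1)
       (of_nat (Poly_Mapping.lookup k i) * Poly_Mapping.lookup h k))" if "Poly_Mapping.keys h \<subseteq> ?A" for h
    unfolding partial_deriv_def using that
    by (intro sum.mono_neutral_left) (auto simp: in_keys_iff)
  show ?thesis
    using *[of f] *[of g] *[OF keys_add]
    by (simp add: lookup_add distrib_left single_add sum.distrib)
qed

lemma partial_deriv_mult:
  "partial_deriv i (f * g) = partial_deriv i f * g + f * partial_deriv i g"
proof (induction f rule: mpoly_induct)
  case (single k c)
  show ?case
  proof (induction g rule: mpoly_induct)
    case (single m d)
    let ?e = "Poly_Mapping.single i (1 :: nat)"
    have shift: "(k - ?e) + m = k + m - ?e" if "Poly_Mapping.lookup k i \<noteq> 0" for k m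
      using that by (intro poly_mapping_eqI) (auto simp: lookup_add lookup_minus lookup_single when_def)
    have "Poly_Mapping.single (k - ?e) (of_nat (Poly_Mapping.lookup k i) * c) * Poly_Mapping.single m d =
        Poly_Mapping.single (k + m - ?e) (of_nat (Poly_Mapping.lookup k i) * (c * d))"
      using shift[of k m] by (cases "Poly_Mapping.lookup k i = 0") (simp_all add: mult_single mult.assoc)
    moreover have "Poly_Mapping.single k c * Poly_Mapping.single (m - ?e) (of_nat (Poly_Mapping.lookup m i) * d) =
        Poly_Mapping.single (k + m - ?e) (of_nat (Poly_Mapping.lookup m i) * (c * d))"
      using shift[of m k] by (cases "Poly_Mapping.lookup m i = 0") (simp_all add: mult_single mult_ac add.commute)
    ultimately show ?case
      by (simp add: mult_single partial_deriv_single lookup_add distrib_right single_add)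
  next
    case (add f g)
    then show ?case by (simp add: partial_deriv_add algebra_simps)
  qed
next
  case (add f g)
  then show ?case by (simp add: partial_deriv_add algebra_simps)
qed

lemma partial_deriv_0 [simp]: "partial_deriv i 0 = 0"
  using partial_deriv_add[of i 0 0] by simp

lemma partial_deriv_power:
  "partial_deriv i (f ^ Suc m) = of_nat (Suc m) * f ^ m * partial_deriv i f"
proof (induction m)
  case (Suc m)
  have "partial_deriv i (f ^ Suc (Suc m)) = partial_deriv i f * f ^ Suc m + f * partial_deriv i (f ^ Suc m)"
    by (simp only: power_Suc[of f "Suc m"] partial_deriv_mult)
  also have "\<dots> = of_nat (Suc (Suc m)) * f ^ Suc m * partial_deriv i f"
    unfolding Suc.IH by (simp add: algebra_simps)
  finally show ?case .
qed simp

text \<open>The derivative of z^p vanishes, so differentiating c * z^p differentiates only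
  c.\<close>

lemma partial_deriv_frobenius_power:
  fixes g :: "('n, 'a::comm_ring_1) mpoly"
  assumes p: "prime CHAR('a)" and g: "g \<in> frobenius_power I 1"
  shows "partial_deriv i g \<in> frobenius_power I 1"
  using g unfolding frobenius_power_def[of I] CHAR_mpoly
proof (induction rule: self_module.span_induct_alt)
  case base
  show ?case by (simp add: self_module.span_zero)
next
  case (step c x y)
  obtain z where z: "z \<in> I" "x = z ^ CHAR('a)" using step by auto
  obtain m where m: "CHAR('a) = Suc m" using p by (metis not_prime_0 old.nat.exhaust)
  have "(of_nat CHAR('a) :: ('n, 'a) mpoly) = 0"
    using of_nat_CHAR[where 'a = "('n, 'a) mpoly"] by (simp only: CHAR_mpoly)
  then have "partial_deriv i x = 0"
    using partial_deriv_power[of i z m] unfolding z(2) m[symmetric] by simp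
  then have "partial_deriv i (c * x + y) = partial_deriv i c * x + partial_deriv i y"
    by (simp add: partial_deriv_add partial_deriv_mult)
  moreover have "x \<in> ideal_gen ((\<lambda>x. x ^ CHAR('a)) ` I)"
    using z by (auto intro: self_module.span_base)
  ultimately show ?case using step by (simp add: self_module.span_add self_module.span_scale)
qed

lemma partial_deriv_ideal_power:
  fixes g :: "('n, 'a::comm_ring_1) mpoly"
  assumes I: "ring_ideal I" and g: "g \<in> ideal_power I (Suc c)"
  shows "partial_deriv i g \<in> ideal_power I c"
  using g
proof (induction c arbitrary: g)
  case (Suc c)
  have "g \<in> ideal_gen {a * b | a b. a \<in> I \<and> b \<in> ideal_power I (Suc c)}"
    using Suc.prems by (simp add: ideal_prod_def)
  then show ?case
  proof (induction rule: self_module.span_induct_alt)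
    case base
    show ?case using self_module.subspace_0[OF ring_ideal_ideal_power[of I "Suc c"]] by simp
  next
    case (step r x y)
    obtain a b where ab: "a \<in> I" "b \<in> ideal_power I (Suc c)" "x = a * b" using step by auto
    have "partial_deriv i (r * x + y) =
        (partial_deriv i (r * a) * b + (r * a) * partial_deriv i b) + partial_deriv i y"
      by (simp add: ab(3) partial_deriv_add mult.assoc[symmetric] partial_deriv_mult)
    moreover have "(r * a) * partial_deriv i b \<in> ideal_power I (Suc c)"
      using Suc.IH[OF ab(2)] ab(1) I by (simp add: ideal_prodI ring_ideal_mult_left)
    ultimately show ?case
      using step ab(2) ring_ideal_mult_left[OF ring_ideal_ideal_power ab(2)]
      by (simp only:) (intro self_module.subspace_add ring_ideal_ideal_power; assumption?; blast?)
  qed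
qed simp

lemma ring_ideal_Jac [simp, intro]: "ring_ideal (Jac f)"
  by (simp add: Jac_def)

lemma Jac_subset: "ring_ideal K \<Longrightarrow> f \<in> K \<Longrightarrow> (\<And>i. partial_deriv i f \<in> K) \<Longrightarrow> Jac f \<subseteq> K"
  unfolding Jac_def by (intro ideal_gen_minimal) auto

lemma self_in_Jac: "f \<in> Jac f"
  unfolding Jac_def by (intro self_module.span_base) auto

lemma partial_deriv_in_Jac: "partial_deriv i f \<in> Jac f"
  unfolding Jac_def by (intro self_module.span_base) auto

section \<open>Lowering the power of f by differentiation\<close>

lemma of_nat_mult_cancel_mpoly:
  fixes z :: "('n, 'a::field) mpoly"
  assumes K: "ring_ideal K" and b: "0 < b" "b < CHAR('a)" and z: "of_nat b * z \<in> K"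
  shows "z \<in> K"
proof -
  have "(of_nat b :: 'a) \<noteq> 0"
    using b by (auto simp: of_nat_eq_0_iff_char_dvd dest: dvd_imp_le)
  then have "Poly_Mapping.single 0 (inverse (of_nat b)) * (of_nat b :: ('n, 'a) mpoly) = 1"
    unfolding single_of_nat[symmetric] mult_single by simp
  then have "Poly_Mapping.single 0 (inverse (of_nat b)) * (of_nat b * z) = z"
    by (simp add: mult.assoc[symmetric])
  then show ?thesis using ring_ideal_mult_left[OF K z] by metis
qed

text \<open>For y in Jac(f)^(c+1), differentiate f^(b+1) y \<in> K. The term with the derivative of
  y is in K, because that derivative still has c Jacobian factors; what remains is b+1, a unit,
  times f^b y times the derivative of f. Of the two extra factors, one is lost in differentiating y,
  the other is the f or derivative of f multiplying f^b y.\<close>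

lemma Jac_descent_step:
  fixes f :: "('n, 'a::field) mpoly"
  assumes K: "ring_ideal K" and closed: "\<And>i x. x \<in> K \<Longrightarrow> partial_deriv i x \<in> K"
    and b: "Suc b < CHAR('a)" and sub: "\<And>z. z \<in> ideal_power (Jac f) c \<Longrightarrow> f ^ Suc b * z \<in> K"
    and z: "z \<in> ideal_power (Jac f) (Suc (Suc c))"
  shows "f ^ b * z \<in> K"
proof -
  have "ideal_prod (Jac f) (ideal_power (Jac f) (Suc c)) \<subseteq> {z. f ^ b * z \<in> K}"
  proof (intro ideal_prod_subset ring_ideal_colon K CollectI)
    fix x y assume x: "x \<in> Jac f" and y: "y \<in> ideal_power (Jac f) (Suc c)"
    have y': "f ^ Suc b * y \<in> K" using sub y ideal_power_Suc_subset by blast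
    have "Jac f \<subseteq> {x. (f ^ b * y) * x \<in> K}"
    proof (intro Jac_subset ring_ideal_colon K CollectI)
      show "f ^ b * y * f \<in> K" using y' by (simp add: mult_ac)
    next
      fix i
      have "partial_deriv i (f ^ Suc b * y) - f ^ Suc b * partial_deriv i y \<in> K"
        using closed[OF y'] sub[OF partial_deriv_ideal_power[OF ring_ideal_Jac y]]
        by (rule self_module.subspace_diff[OF K])
      moreover have "partial_deriv i (f ^ Suc b * y) - f ^ Suc b * partial_deriv i y =
          of_nat (Suc b) * (f ^ b * y * partial_deriv i f)"
        unfolding partial_deriv_mult partial_deriv_power by (simp add: algebra_simps)
      ultimately show "f ^ b * y * partial_deriv i f \<in> K"
        using of_nat_mult_cancel_mpoly[OF K _ b] by simp
    qed
    then show "f ^ b * (x * y) \<in> K" using x by (auto simp: mult_ac)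
  qed
  then show ?thesis using z by auto
qed

lemma Jac_descent:
  fixes f :: "('n, 'a::field) mpoly"
  assumes K: "ring_ideal K" and closed: "\<And>i x. x \<in> K \<Longrightarrow> partial_deriv i x \<in> K"
    and b: "b + j < CHAR('a)" and sub: "\<And>z. z \<in> ideal_power (Jac f) c \<Longrightarrow> f ^ (b + j) * z \<in> K"
    and z: "z \<in> ideal_power (Jac f) (c + 2 * j)"
  shows "f ^ b * z \<in> K"
  using b sub z
proof (induction j arbitrary: b z)
  case (Suc j)
  have "f ^ Suc b * z \<in> K" if "z \<in> ideal_power (Jac f) (c + 2 * j)" for z
    using Suc.IH[of "Suc b" z] Suc.prems that by simp
  then show ?case
    using Jac_descent_step[OF K closed, of b f "c + 2 * j" z] Suc.prems by simp
qed simp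

text \<open>Applied with \<open>W\<close> the whole ring; general \<open>W\<close> is for the
  induction on the number of digits. In the application \<open>u\<close> is the denominator with
  which h lies in Jac(f)^4 after localization.\<close>

lemma perturbation_mem_frobenius_power:
  fixes f h u :: "('n, 'a::field) mpoly"
  assumes p: "prime CHAR('a)" and J: "ring_ideal J" and sat: "\<And>x. u * x \<in> J \<Longrightarrow> x \<in> J"
    and h: "u * h \<in> ideal_power (Jac f) 4"
    and a: "a < CHAR('a) ^ e" and W: "ideal_power (Jac f) 2 \<subseteq> W"
    and fW: "\<And>w. w \<in> W \<Longrightarrow> f ^ a * w \<in> frobenius_power J e" and w: "w \<in> W"
  shows "(f + h) ^ a * w \<in> frobenius_power J e"
  using a W fW w
proof (induction e arbitrary: a W w)
  \<comment> \<open>Here a < 1, so a = 0 and both powers are 1.\<close>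
  case 0
  then show ?case by simp
next
  case (Suc e)
  let ?p = "CHAR('a)"
  define a' a0 where "a' = a div ?p" and "a0 = a mod ?p"
  have a: "a = a' * ?p + a0" by (simp add: a'_def a0_def)
  have a0: "a0 < ?p" using p by (simp add: a0_def prime_gt_0_nat)
  have a': "a' < ?p ^ e"
    using Suc.prems(1) by (simp add: a'_def less_mult_imp_div_less mult.commute)
  \<comment> \<open>Splitting off the last digit: f^a * w \<in> J^[p^(e+1)] is equivalent to f^a0 *
    w \<in> \<open>K\<close>. As a Frobenius power, \<open>K\<close> is stable under derivations;
    \<open>W'\<close> is the multiplier set for the remaining digits.\<close>
  define W' where "W' = {z. f ^ a' * z \<in> frobenius_power J e}"
  define K where "K = frobenius_power W' 1"
  have W': "ring_ideal W'" unfolding W'_def by (intro ring_ideal_colon ring_ideal_frobenius_power)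
  have K: "ring_ideal K" by (simp add: K_def)
  have closed: "partial_deriv i x \<in> K" if "x \<in> K" for i x
    using that unfolding K_def by (rule partial_deriv_frobenius_power[OF p])
  have satW': "x \<in> W'" if "u * x \<in> W'" for x
    using that frobenius_power_saturated_mpoly[OF p J sat, where x = "f ^ a' * x"]
    by (simp add: W'_def mult.left_commute)
  have satK: "x \<in> K" if "u * x \<in> K" for x
    using that frobenius_power_saturated_mpoly[OF p W' satW', where e = 1] by (simp add: K_def)
  have split: "g ^ a = (g ^ a') ^ ?p * g ^ a0" for g :: "('n, 'a) mpoly"
    by (simp add: a power_add power_mult)
  have twice: "frobenius_power J (Suc e) = frobenius_power (frobenius_power J e) 1"
    using frobenius_power_frobenius_power[of J e 1] p by (simp add: CHAR_mpoly)
  have colon: "c ^ ?p * x \<in> frobenius_power J (Suc e) \<longleftrightarrow>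
      x \<in> frobenius_power {z. c * z \<in> frobenius_power J e} 1" for c x
    using frobenius_power_colon_mpoly[OF p ring_ideal_frobenius_power[of J e], where c = c and x = x and e = 1]
    by (simp add: twice)
  have fK: "f ^ a0 * w \<in> K" if "w \<in> W" for w
    using Suc.prems(3)[OF that] unfolding split mult.assoc colon K_def W'_def .
  have descent: "f ^ b * z \<in> K" if "b + j = a0" "z \<in> ideal_power (Jac f) (2 + 2 * j)" for b j z
    using Jac_descent[OF K closed, of b j f 2 z] that a0 fK Suc.prems(2) by blast
  \<comment> \<open>Descent to exponent 0 puts Jac(f)^(2 + 2 a0) into \<open>K\<close>. Since 2 + 2
    a0 \<le> 2p, this contains x^p for x in Jac(f)^2, and x^p \<in> W'^[p] gives x \<in> W'.\<close>
  have W'_sup: "ideal_power (Jac f) 2 \<subseteq> W'"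
  proof
    fix x assume "x \<in> ideal_power (Jac f) 2"
    then have "x ^ ?p \<in> ideal_power (Jac f) (2 * ?p)" by (rule ideal_power_power)
    then have "x ^ ?p \<in> ideal_power (Jac f) (2 + 2 * a0)"
      using a0 ideal_power_antimono[of "2 + 2 * a0" "2 * ?p" "Jac f"] by auto
    then have "x ^ ?p \<in> K" using descent[of 0 a0] by simp
    then show "x \<in> W'"
      using power_mem_frobenius_power_mpoly_iff[OF p W', where e = 1 and x = x] by (simp add: K_def)
  qed
  have "(f + h) ^ a' * z \<in> frobenius_power J e" if "z \<in> W'" for z
    using Suc.IH[OF a' W'_sup _ that] by (simp add: W'_def)
  then have sub: "K \<subseteq> frobenius_power {z. (f + h) ^ a' * z \<in> frobenius_power J e} 1"
    unfolding K_def by (intro frobenius_power_mono) auto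
  \<comment> \<open>For j > 0 the 4j Jacobian factors of (u h)^j cover the 2 + 2j needed to lower
    the power of f by j. For j = 0 the hypothesis on w is used directly, as w need not lie in
    Jac(f)^2.\<close>
  have summand: "f ^ (a0 - j) * h ^ j * w \<in> K" if j: "j \<le> a0" for j
  proof (cases "j = 0")
    case True
    then show ?thesis using fK[OF Suc.prems(4)] by simp
  next
    case False
    have "(u * h) ^ j * w \<in> ideal_power (Jac f) (4 * j)"
      by (intro ring_ideal_mult_right ring_ideal_ideal_power ideal_power_power h)
    then have "(u * h) ^ j * w \<in> ideal_power (Jac f) (2 + 2 * j)"
      using False ideal_power_antimono[of "2 + 2 * j" "4 * j" "Jac f"] by auto
    then have "f ^ (a0 - j) * ((u * h) ^ j * w) \<in> K"
      using descent[of "a0 - j" j] j by simp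
    then have "u ^ j * (f ^ (a0 - j) * h ^ j * w) \<in> K"
      by (simp add: power_mult_distrib mult_ac)
    moreover have "x \<in> K" if "u ^ m * x \<in> K" for m x
      using that
    proof (induction m)
      case (Suc m)
      have "u * (u ^ m * x) \<in> K" using Suc.prems by (simp only: power_Suc mult.assoc)
      then show ?case using satK Suc.IH by blast
    qed simp
    ultimately show ?thesis by blast
  qed
  have "(f + h) ^ a0 * w = (\<Sum>j\<le>a0. of_nat (a0 choose j) * (f ^ (a0 - j) * h ^ j * w))"
    unfolding add.commute[of f h] binomial_ring sum_distrib_right by (simp add: mult_ac)
  also have "\<dots> \<in> K"
    by (rule self_module.subspace_sum[OF K], rule ring_ideal_mult_left[OF K], rule summand) simp
  finally show ?case
    using sub unfolding split mult.assoc colon by blast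
qed

section \<open>Jumping numbers in the localization\<close>

lemma ring_ideal_image_mult:
  assumes "ring_ideal I"
  shows "ring_ideal ((*) c ` I)"
proof (rule self_module.subspaceI)
  show "0 \<in> (*) c ` I" using self_module.subspace_0[OF assms] by force
  show "x + y \<in> (*) c ` I" if xy: "x \<in> (*) c ` I" "y \<in> (*) c ` I" for x y
  proof -
    obtain a b where "a \<in> I" "b \<in> I" "x = c * a" "y = c * b" using xy by blast
    then show ?thesis
      by (intro image_eqI[of _ _ "a + b"]) (auto simp: distrib_left self_module.subspace_add[OF assms])
  qed
  show "r * x \<in> (*) c ` I" if x: "x \<in> (*) c ` I" for r x
  proof -
    obtain a where "a \<in> I" "x = c * a" using x by blast
    then show ?thesis
      by (intro image_eqI[of _ _ "r * a"]) (auto simp: mult.left_commute ring_ideal_mult_left[OF assms])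
  qed
qed

text \<open>Both sides are contained in the same ideals J, since by the colon lemma g^(q+a) \<in>
  J^[q] iff g^a \<in> (J : g)^[q]. Being ideals themselves, they coincide.\<close>

lemma frobenius_root_local_shift:
  fixes g :: "('n::{finite,linorder}, 'a::field) mpoly"
  assumes p: "prime CHAR('a)"
  shows "frobenius_root (to_local g ^ (CHAR('a) ^ e + a)) e =
    (*) (to_local g) ` frobenius_root (to_local g ^ a) e" (is "?L = ?R")
proof -
  have L: "ring_ideal ?L"
    using ring_ideal_frobenius_root_local[OF p, of "g ^ (CHAR('a) ^ e + a)" e] by (simp only: to_local_power)
  have R: "ring_ideal ?R"
    using ring_ideal_image_mult[OF ring_ideal_frobenius_root_local[OF p, of "g ^ a" e], of "to_local g"]
    by (simp only: to_local_power)
  have "?L \<subseteq> J \<longleftrightarrow> ?R \<subseteq> J" if J: "ring_ideal J" for J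
  proof -
    have "?L \<subseteq> J \<longleftrightarrow> g ^ (CHAR('a) ^ e) * g ^ a \<in> frobenius_power (to_local -` J) e"
      unfolding frobenius_root_local_subset_iff[OF p J, symmetric]
      by (simp only: to_local_power power_add to_local_mult)
    also have "\<dots> \<longleftrightarrow> g ^ a \<in> frobenius_power {z. g * z \<in> to_local -` J} e"
      by (rule frobenius_power_colon_mpoly[OF p ring_ideal_contraction[OF J]])
    also have "{z. g * z \<in> to_local -` J} = to_local -` {z. to_local g * z \<in> J}"
      by (auto simp: to_local_mult)
    also have "g ^ a \<in> frobenius_power \<dots> e \<longleftrightarrow> frobenius_root (to_local g ^ a) e \<subseteq> {z. to_local g * z \<in> J}"
      unfolding frobenius_root_local_subset_iff[OF p ring_ideal_colon[OF J], symmetric]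
      by (simp only: to_local_power)
    also have "\<dots> \<longleftrightarrow> ?R \<subseteq> J" by blast
    finally show ?thesis .
  qed
  from this[OF L] this[OF R] show ?thesis by blast
qed

text \<open>Skoda's theorem for a principal ideal. The sign of t matters because \<open>nat\<close>
  truncates negative ceilings.\<close>

lemma test_ideal_local_shift:
  fixes g :: "('n::{finite,linorder}, 'a::field) mpoly"
  assumes p: "prime CHAR('a)" and t: "0 \<le> t"
  shows "test_ideal (to_local g) (t + 1) = (*) (to_local g) ` test_ideal (to_local g) t"
proof -
  have "nat \<lceil>real q * (t + 1)\<rceil> = q + nat \<lceil>real q * t\<rceil>" for q
  proof -
    have "real q * (t + 1) = real q * t + of_int (int q)" by (simp add: algebra_simps)
    then have "\<lceil>real q * (t + 1)\<rceil> = \<lceil>real q * t\<rceil> + int q" by (simp only: ceiling_add_of_int)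
    moreover have "0 \<le> real q * t" using t by simp
    ultimately show ?thesis by linarith
  qed
  then show ?thesis
    unfolding test_ideal_local image_UN by (simp only: frobenius_root_local_shift[OF p])
qed

lemma to_local_nonunit: "g \<in> origin_ideal \<Longrightarrow> v * to_local g \<noteq> 1"
proof
  assume g: "g \<in> origin_ideal" and v: "v * to_local g = 1"
  obtain a s where s: "s \<notin> origin_ideal" "to_local s * v = to_local a"
    using local_ring_fraction .
  have "to_local (a * g) = to_local s * (v * to_local g)"
    by (simp add: to_local_mult mult.assoc flip: s(2))
  then have "s = a * g" using v by (simp add: to_local_eq_iff)
  then show False using g s(1) by (simp add: origin_ideal_complement)
qed

lemma test_ideal_local_proper:
  fixes g :: "('n::{finite,linorder}, 'a::field) mpoly"
  assumes p: "prime CHAR('a)" and t: "1 \<le> t" and g: "g \<in> origin_ideal"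
  shows "test_ideal (to_local g) t \<noteq> UNIV"
proof
  assume "test_ideal (to_local g) t = UNIV"
  then have "1 \<in> ideal_gen {to_local g}" using test_ideal_local_subset[OF p t] by blast
  then obtain v where "1 = v * to_local g" by (auto simp: self_module.span_singleton)
  then show False using to_local_nonunit[OF g] by metis
qed

lemma ceiling_exponent_less:
  fixes t :: real
  assumes p: "prime (p::nat)" and t: "t < 1"
  obtains m where "\<forall>e\<ge>m. nat \<lceil>real (p ^ e) * t\<rceil> < p ^ e"
proof -
  obtain m where m: "1 / (1 - t) < real p ^ m"
    using real_arch_pow[of "real p" "1 / (1 - t)"] prime_gt_1_nat[OF p] by auto
  have "nat \<lceil>real (p ^ e) * t\<rceil> < p ^ e" if "m \<le> e" for e
  proof -
    have "real p ^ m \<le> real p ^ e"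
      using that prime_gt_1_nat[OF p] by (intro power_increasing) auto
    then have "1 / (1 - t) \<le> real (p ^ e)" using m by simp
    then have "1 \<le> real (p ^ e) * (1 - t)" using t by (simp add: pos_divide_le_eq)
    then have "real (p ^ e) * t \<le> real (p ^ e) - 1" by (simp add: right_diff_distrib)
    then have "\<lceil>real (p ^ e) * t\<rceil> \<le> int (p ^ e) - 1" unfolding ceiling_le_iff by simp
    moreover have "0 < p ^ e" using p by (simp add: prime_gt_0_nat)
    ultimately show ?thesis by linarith
  qed
  then show ?thesis using that by blast
qed

text \<open>Equality would put the test ideal at t inside (g), hence g^a into (g)^[q] = (g^q) for
  some a < q; cancelling g^a makes g a unit. So 1 is a jumping number.\<close>

lemma test_ideal_local_less_1:
  fixes g :: "('n::{finite,linorder}, 'a::field) mpoly"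
  assumes p: "prime CHAR('a)" and t: "t < 1" and g: "g \<in> origin_ideal" "g \<noteq> 0"
  shows "test_ideal (to_local g) 1 \<noteq> test_ideal (to_local g) t"
proof
  assume eq: "test_ideal (to_local g) 1 = test_ideal (to_local g) t"
  let ?J = "ideal_gen {to_local g}"
  obtain m where m: "\<forall>e\<ge>m. nat \<lceil>real (CHAR('a) ^ e) * t\<rceil> < CHAR('a) ^ e"
    using ceiling_exponent_less[OF p t] .
  \<comment> \<open>\<open>Suc m\<close> rather than m, because the union in a test ideal starts at
    e = 1.\<close>
  define e where "e = Suc m"
  define q where "q = CHAR('a) ^ e"
  define a where "a = nat \<lceil>real q * t\<rceil>"
  have a: "a < q" unfolding a_def q_def by (rule m[rule_format]) (simp add: e_def)
  have "frobenius_root (to_local g ^ a) e \<subseteq> test_ideal (to_local g) t"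
    unfolding test_ideal_local a_def q_def by (rule UN_upper) (simp add: e_def)
  also have "\<dots> \<subseteq> ?J" using test_ideal_local_subset[OF p order_refl, of g] eq by simp
  finally have "frobenius_root (to_local (g ^ a)) e \<subseteq> ?J" by (simp only: to_local_power)
  then have "to_local (g ^ a) \<in> frobenius_power ?J e"
    unfolding frobenius_root_local_subset_iff[OF p ring_ideal_ideal_gen]
      frobenius_power_local_iff[OF p ring_ideal_ideal_gen] .
  also have "\<dots> \<subseteq> (*) (to_local g ^ q) ` UNIV"
    unfolding frobenius_power_def CHAR_local_ring q_def
    by (intro ideal_gen_minimal ring_ideal_image_mult ring_ideal_UNIV)
      (auto simp: self_module.span_singleton power_mult_distrib mult.commute)
  finally obtain c where "to_local g ^ a = to_local g ^ q * c" by (auto simp: to_local_power)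
  also have "\<dots> = to_local g ^ a * (c * to_local g ^ (q - Suc a) * to_local g)"
    using a by (simp add: mult_ac flip: power_Suc power_add)
  finally have "to_local g ^ a * (c * to_local g ^ (q - Suc a) * to_local g) = to_local g ^ a * 1"
    by simp
  moreover have "to_local g \<noteq> 0" using g(2) to_local_eq_iff[of g 0] by simp
  ultimately have "c * to_local g ^ (q - Suc a) * to_local g = 1"
    unfolding mult_cancel_left by simp
  then show False using to_local_nonunit[OF g(1)] by blast
qed

text \<open>Test ideals decrease in the exponent, so equality at some \<epsilon> forces equality at
  all smaller ones. Restricting the range lets \<xi> and \<xi> + 1 be tested on the same
  \<epsilon>.\<close>

lemma F_jumping_numbers_local_iff:
  fixes g :: "('n::{finite,linorder}, 'a::field) mpoly"
  assumes p: "prime CHAR('a)" and \<delta>: "0 < \<delta>" "\<delta> \<le> \<xi>"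
  shows "\<xi> \<in> F_jumping_numbers (to_local g) \<longleftrightarrow>
    (\<forall>\<epsilon>. 0 < \<epsilon> \<and> \<epsilon> < \<delta> \<longrightarrow> test_ideal (to_local g) \<xi> \<noteq> test_ideal (to_local g) (\<xi> - \<epsilon>))"
    (is "?L \<longleftrightarrow> ?R")
proof
  assume R: ?R
  have "test_ideal (to_local g) \<xi> \<noteq> test_ideal (to_local g) (\<xi> - \<epsilon>)" if \<epsilon>: "0 < \<epsilon>" for \<epsilon>
  proof
    assume eq: "test_ideal (to_local g) \<xi> = test_ideal (to_local g) (\<xi> - \<epsilon>)"
    define \<epsilon>' where "\<epsilon>' = min \<epsilon> (\<delta> / 2)"
    have \<epsilon>': "0 < \<epsilon>'" "\<epsilon>' < \<delta>" "\<epsilon>' \<le> \<epsilon>" using \<epsilon> \<delta> by (auto simp: \<epsilon>'_def)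
    have "test_ideal (to_local g) (\<xi> - \<epsilon>') \<subseteq> test_ideal (to_local g) (\<xi> - \<epsilon>)"
      by (rule test_ideal_local_antimono[OF p]) (use \<epsilon>' in simp)
    moreover have "test_ideal (to_local g) \<xi> \<subseteq> test_ideal (to_local g) (\<xi> - \<epsilon>')"
      by (rule test_ideal_local_antimono[OF p]) (use \<epsilon>' in simp)
    ultimately show False using R \<epsilon>' eq by blast
  qed
  then show ?L using \<delta> by (auto simp: F_jumping_numbers_def)
qed (use \<delta> in \<open>auto simp: F_jumping_numbers_def\<close>)

lemma F_jumping_numbers_local_shift:
  fixes g :: "('n::{finite,linorder}, 'a::field) mpoly"
  assumes p: "prime CHAR('a)" and g: "g \<noteq> 0" and \<xi>: "0 < \<xi>"
  shows "\<xi> + 1 \<in> F_jumping_numbers (to_local g) \<longleftrightarrow> \<xi> \<in> F_jumping_numbers (to_local g)"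
proof -
  have "to_local g \<noteq> 0" using g to_local_eq_iff[of g 0] by simp
  then have inj: "inj ((*) (to_local g))" by (simp add: inj_on_def)
  have "test_ideal (to_local g) (\<xi> + 1) = test_ideal (to_local g) (\<xi> + 1 - \<epsilon>) \<longleftrightarrow>
      test_ideal (to_local g) \<xi> = test_ideal (to_local g) (\<xi> - \<epsilon>)" if "\<epsilon> < \<xi>" for \<epsilon>
    using test_ideal_local_shift[OF p, of \<xi> g] test_ideal_local_shift[OF p, of "\<xi> - \<epsilon>" g] that \<xi>
    by (simp add: inj_image_eq_iff[OF inj] diff_add_eq)
  then show ?thesis
    using F_jumping_numbers_local_iff[OF p \<xi>, of "\<xi> + 1" g] F_jumping_numbers_local_iff[OF p \<xi> order_refl, of g]
    by (simp cong: conj_cong)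
qed

text \<open>Below 1 the assumption applies, 1 itself belongs to both sets, and larger numbers are
  shifted down one unit at a time.\<close>

lemma F_jumping_numbers_local_cong:
  fixes f g :: "('n::{finite,linorder}, 'a::field) mpoly"
  assumes p: "prime CHAR('a)" and f: "f \<in> origin_ideal" "f \<noteq> 0" and g: "g \<in> origin_ideal" "g \<noteq> 0"
    and eq: "\<And>t. 0 \<le> t \<Longrightarrow> t < 1 \<Longrightarrow> test_ideal (to_local f) t = test_ideal (to_local g) t"
  shows "F_jumping_numbers (to_local f) = F_jumping_numbers (to_local g)"
proof -
  have below_1: "\<xi> \<in> F_jumping_numbers (to_local f) \<longleftrightarrow> \<xi> \<in> F_jumping_numbers (to_local g)"
    if "0 < \<xi>" "\<xi> < 1" for \<xi>
    using that eq by (simp add: F_jumping_numbers_def)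
  have at_1: "1 \<in> F_jumping_numbers (to_local h)" if "h \<in> origin_ideal" "h \<noteq> 0"
    for h :: "('n, 'a) mpoly"
    unfolding F_jumping_numbers_local_iff[OF p zero_less_one order_refl]
    using test_ideal_local_less_1[OF p _ that] by simp
  have "\<xi> \<in> F_jumping_numbers (to_local f) \<longleftrightarrow> \<xi> \<in> F_jumping_numbers (to_local g)"
    if "0 < \<xi>" "\<xi> < real n + 1" for \<xi> n
    using that
  proof (induction n arbitrary: \<xi>)
    case 0
    then show ?case using below_1 by simp
  next
    case (Suc n)
    consider "\<xi> < 1" | "\<xi> = 1" | "\<xi> > 1" by linarith
    then show ?case
    proof cases
      case 3
      then show ?thesis
        using Suc.IH[of "\<xi> - 1"] Suc.prems F_jumping_numbers_local_shift[OF p f(2), of "\<xi> - 1"]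
          F_jumping_numbers_local_shift[OF p g(2), of "\<xi> - 1"] by simp
    qed (use Suc.prems below_1 at_1 f g in auto)
  qed
  moreover have "\<xi> < real (nat \<lceil>\<xi>\<rceil>) + 1" for \<xi> by linarith
  ultimately have pos: "\<xi> \<in> F_jumping_numbers (to_local f) \<longleftrightarrow> \<xi> \<in> F_jumping_numbers (to_local g)"
    if "0 < \<xi>" for \<xi> using that by blast
  have "\<xi> \<in> F_jumping_numbers (to_local h) \<longleftrightarrow> \<xi> = 0" if "\<xi> \<le> 0" for \<xi> and h :: "('n, 'a) mpoly"
    using that by (auto simp: F_jumping_numbers_def)
  then show ?thesis using pos by (metis linorder_not_le subsetI subset_antisym)
qed

text \<open>For t \<ge> 1 the test ideal lies in a proper principal ideal, so only exponents below 1
  enter the suprema.\<close>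

lemma fpt_local_cong:
  fixes f g :: "('n::{finite,linorder}, 'a::field) mpoly"
  assumes p: "prime CHAR('a)" and f: "f \<in> origin_ideal" and g: "g \<in> origin_ideal"
    and eq: "\<And>t. 0 \<le> t \<Longrightarrow> t < 1 \<Longrightarrow> test_ideal (to_local f) t = test_ideal (to_local g) t"
  shows "fpt (to_local f) = fpt (to_local g)"
proof -
  have "t > 0 \<and> test_ideal (to_local f) t = UNIV \<longleftrightarrow> t > 0 \<and> test_ideal (to_local g) t = UNIV" for t
    using eq[of t] test_ideal_local_proper[OF p _ f, of t] test_ideal_local_proper[OF p _ g, of t]
    by (cases "t < 1") auto
  then show ?thesis by (simp add: fpt_def)
qed

text \<open>Take J to be the root of f^a, so that f^a lies in the Frobenius power of its
  contraction. The perturbation lemma carries this over to g^a, which places the root of g^a inside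
  J.\<close>

lemma test_ideal_local_perturbation_subset:
  fixes f g :: "('n::{finite,linorder}, 'a::field) mpoly"
  assumes p: "prime CHAR('a)" and u: "u \<notin> origin_ideal" "u * (g - f) \<in> ideal_power (Jac f) 4"
    and t: "t < 1"
  shows "test_ideal (to_local g) t \<subseteq> test_ideal (to_local f) t"
proof -
  have root: "frobenius_root (to_local g ^ a) e \<subseteq> frobenius_root (to_local f ^ a) e"
    if a: "a < CHAR('a) ^ e" for a e
  proof -
    let ?J = "frobenius_root (to_local (f ^ a)) e"
    note J = ring_ideal_frobenius_root_local[OF p, of "f ^ a" e]
    have "f ^ a \<in> frobenius_power (to_local -` ?J) e"
      using frobenius_root_local_subset_iff[OF p J, of "f ^ a" e] by simp
    then have "(f + (g - f)) ^ a * 1 \<in> frobenius_power (to_local -` ?J) e"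
      by (intro perturbation_mem_frobenius_power[OF p ring_ideal_contraction[OF J]
            contraction_saturated[OF J u(1)] u(2) a, where W = UNIV])
        (auto intro: ring_ideal_mult_right)
    then show ?thesis
      using frobenius_root_local_subset_iff[OF p J, of "g ^ a" e] by (simp add: to_local_power)
  qed
  obtain m where "\<forall>e\<ge>m. nat \<lceil>real (CHAR('a) ^ e) * t\<rceil> < CHAR('a) ^ e"
    using ceiling_exponent_less[OF p t] .
  then show ?thesis
    unfolding test_ideal_local_tail[OF p, where m = m] by (intro UN_mono root) auto
qed

section \<open>The maximal ideal of the origin\<close>

lemma ring_ideal_origin_ideal [simp, intro]: "ring_ideal origin_ideal"
  by (simp add: origin_ideal_def)

lemma origin_ideal_power_subset_degree:
  "ideal_power (origin_ideal :: ('n::finite, 'a::comm_ring_1) mpoly set) m \<subseteq>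
     ideal_gen {Poly_Mapping.single k 1 | k. m \<le> (\<Sum>i\<in>UNIV. Poly_Mapping.lookup k i)}"
proof (induction m)
  case 0
  have "1 \<in> ideal_gen {Poly_Mapping.single k (1 :: 'a) | k :: 'n \<Rightarrow>\<^sub>0 nat. 0 \<le> (\<Sum>i\<in>UNIV. Poly_Mapping.lookup k i)}"
    by (intro self_module.span_base CollectI exI[of _ 0]) simp
  from ring_ideal_mult_left[OF ring_ideal_ideal_gen this] show ?case by auto
next
  case (Suc m)
  let ?D = "\<lambda>m. {Poly_Mapping.single k (1 :: 'a) | k :: 'n \<Rightarrow>\<^sub>0 nat. m \<le> (\<Sum>i\<in>UNIV. Poly_Mapping.lookup k i)}"
  have "Var i * Poly_Mapping.single k 1 \<in> ?D (Suc m)"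
    if k: "m \<le> (\<Sum>i\<in>UNIV. Poly_Mapping.lookup k i)" for i :: 'n and k
    using k by (auto simp: Var_def mult_single lookup_add sum.distrib lookup_single when_def intro!: exI[of _ "Poly_Mapping.single i 1 + k"])
  then have gen: "Var i * Poly_Mapping.single k 1 \<in> ideal_gen (?D (Suc m))"
    if "m \<le> (\<Sum>i\<in>UNIV. Poly_Mapping.lookup k i)" for i :: 'n and k
    using that self_module.span_base by blast
  have Var: "ideal_gen (?D m) \<subseteq> {y. Var i * y \<in> ideal_gen (?D (Suc m))}" for i
    by (intro ideal_gen_minimal ring_ideal_colon ring_ideal_ideal_gen) (use gen in auto)
  have "ideal_prod origin_ideal (ideal_power origin_ideal m) \<subseteq> ideal_gen (?D (Suc m))"
  proof (intro ideal_prod_subset ring_ideal_ideal_gen)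
    fix x y :: "('n, 'a) mpoly"
    assume x: "x \<in> origin_ideal" and y: "y \<in> ideal_power origin_ideal m"
    have "origin_ideal \<subseteq> {x. y * x \<in> ideal_gen (?D (Suc m))}"
      unfolding origin_ideal_def
      by (intro ideal_gen_minimal ring_ideal_colon ring_ideal_ideal_gen)
        (use Var Suc.IH y in \<open>auto simp: mult.commute[of y]\<close>)
    then show "x * y \<in> ideal_gen (?D (Suc m))" using x by (auto simp: mult.commute[of y])
  qed
  then show ?case by simp
qed

lemma Var_power: "Var i ^ m = Poly_Mapping.single (Poly_Mapping.single i m) 1"
proof -
  have "Poly_Mapping.map ((*) m) (Poly_Mapping.single i 1) = Poly_Mapping.single i m"
    by (rule poly_mapping_eqI) (simp add: lookup_map_0 lookup_single when_def)
  then show ?thesis by (simp add: Var_def single_power)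
qed

text \<open>Some power of each variable lies in I. By the pigeonhole principle, a monomial whose
  degree reaches the sum of these exponents is divisible by one of these powers.\<close>

lemma origin_ideal_power_subset:
  fixes I :: "('n::finite, 'a::comm_ring_1) mpoly set"
  assumes I: "ring_ideal I" and rad: "origin_ideal \<subseteq> ideal_radical I"
  obtains m where "ideal_power origin_ideal m \<subseteq> I"
proof -
  have "\<exists>k. Var i ^ k \<in> I" for i
  proof -
    have "Var i \<in> origin_ideal" unfolding origin_ideal_def by (rule self_module.span_base) simp
    then show ?thesis using rad by (auto simp: ideal_radical_def)
  qed
  then obtain k where k: "\<And>i. Var i ^ k i \<in> I" by metis
  define m where "m = (\<Sum>i\<in>UNIV. k i)"
  have "ideal_gen {Poly_Mapping.single \<kappa> 1 | \<kappa>. m \<le> (\<Sum>i\<in>UNIV. Poly_Mapping.lookup \<kappa> i)} \<subseteq> I"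
  proof (intro ideal_gen_minimal I, safe)
    fix \<kappa> :: "'n \<Rightarrow>\<^sub>0 nat"
    assume "m \<le> (\<Sum>i\<in>UNIV. Poly_Mapping.lookup \<kappa> i)"
    then have "\<not> (\<Sum>i\<in>UNIV. Poly_Mapping.lookup \<kappa> i) < (\<Sum>i\<in>UNIV. k i)" by (simp add: m_def)
    then obtain i where i: "k i \<le> Poly_Mapping.lookup \<kappa> i"
      by (meson UNIV_I UNIV_not_empty finite not_le sum_strict_mono)
    have "(\<kappa> - Poly_Mapping.single i (k i)) + Poly_Mapping.single i (k i) = \<kappa>"
      using i by (intro poly_mapping_eqI) (auto simp: lookup_add lookup_minus lookup_single when_def)
    then have "Poly_Mapping.single \<kappa> 1 = Poly_Mapping.single (\<kappa> - Poly_Mapping.single i (k i)) 1 * Var i ^ k i"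
      by (simp add: Var_power mult_single)
    then show "Poly_Mapping.single \<kappa> 1 \<in> I" using ring_ideal_mult_left[OF I k] by metis
  qed
  then show ?thesis using origin_ideal_power_subset_degree[of m] that by blast
qed

text \<open>Nakayama's lemma, with a denominator outside the maximal ideal instead of localized
  modules.\<close>

lemma nakayama_origin_ideal:
  fixes N :: "('n, 'a::idom) mpoly set"
  assumes "finite G"
    and "\<And>g. g \<in> G \<Longrightarrow>
      \<exists>s. s \<notin> origin_ideal \<and> s * g \<in> ideal_gen (N \<union> {a * g | a g. a \<in> origin_ideal \<and> g \<in> G})"
  shows "\<exists>s. s \<notin> origin_ideal \<and> (\<forall>g\<in>G. s * g \<in> ideal_gen N)"
  using assms
proof (induction G rule: finite_induct)
  case empty
  then show ?case using origin_ideal_complement(1) by blast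
next
  case (insert x G)
  let ?T = "\<lambda>G. ideal_gen (N \<union> {a * g | a g. a \<in> origin_ideal \<and> g \<in> G})"
  \<comment> \<open>Everything involving x is collected into a single coefficient from the maximal
    ideal.\<close>
  have split: "\<exists>a. a \<in> origin_ideal \<and> y - a * x \<in> ?T G" if "y \<in> ?T (insert x G)" for y
    using that
  proof (induction rule: self_module.span_induct_alt)
    case base
    show ?case
      using self_module.span_zero self_module.subspace_0[OF ring_ideal_origin_ideal] by (intro exI[of _ 0]) auto
  next
    case (step c z y)
    obtain b where b: "b \<in> origin_ideal" "y - b * x \<in> ?T G" using step by blast
    have "\<exists>a. a \<in> origin_ideal \<and> z - a * x \<in> ?T G"
    proof (cases "z \<in> N \<union> {a * g | a g. a \<in> origin_ideal \<and> g \<in> G}")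
      case True
      then have "z \<in> ?T G" by (rule self_module.span_base)
      then show ?thesis
        using self_module.subspace_0[OF ring_ideal_origin_ideal] by (intro exI[of _ 0]) auto
    next
      case False
      then obtain a where "a \<in> origin_ideal" "z = a * x" using step.hyps by blast
      then show ?thesis using self_module.span_zero by (intro exI[of _ a]) auto
    qed
    then obtain a where a: "a \<in> origin_ideal" "z - a * x \<in> ?T G" by blast
    have "c * (z - a * x) + (y - b * x) \<in> ?T G"
      by (rule self_module.span_add[OF self_module.span_scale[OF a(2)] b(2)])
    moreover have "c * (z - a * x) + (y - b * x) = (c * z + y) - (c * a + b) * x"
      by (simp add: algebra_simps)
    moreover have "c * a + b \<in> origin_ideal"
      using a b by (simp add: self_module.subspace_add ring_ideal_mult_left)
    ultimately show ?case by (intro exI[of _ "c * a + b"]) (simp only: simp_thms)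
  qed
  obtain s a where s: "s \<notin> origin_ideal" and a: "a \<in> origin_ideal" "s * x - a * x \<in> ?T G"
    using insert.prems[of x] split by blast
  \<comment> \<open>Modulo the remaining generators s * x agrees with a * x, so s - a multiplies x
    into them; it stays outside the maximal ideal because a lies inside. This eliminates x.\<close>
  define w where "w = s - a"
  have w: "w \<notin> origin_ideal"
  proof
    assume "w \<in> origin_ideal"
    then have "w + a \<in> origin_ideal" using a by (simp add: self_module.subspace_add)
    then show False using s by (simp add: w_def)
  qed
  have wx: "w * x \<in> ?T G" using a by (simp add: w_def left_diff_distrib)
  have "\<exists>s. s \<notin> origin_ideal \<and> s * g \<in> ?T G" if g: "g \<in> G" for g
  proof -
    obtain s b where s: "s \<notin> origin_ideal" and b: "b \<in> origin_ideal" "s * g - b * x \<in> ?T G"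
      using insert.prems[of g] g split by blast
    have "w * (s * g - b * x) + b * (w * x) \<in> ?T G"
      by (rule self_module.span_add[OF self_module.span_scale[OF b(2)] self_module.span_scale[OF wx]])
    moreover have "w * (s * g - b * x) + b * (w * x) = (w * s) * g" by (simp add: algebra_simps)
    moreover have "w * s \<notin> origin_ideal" using s w by (simp add: origin_ideal_complement)
    ultimately show ?thesis by (intro exI[of _ "w * s"]) (simp only: simp_thms)
  qed
  then obtain s' where s': "s' \<notin> origin_ideal" "\<forall>g\<in>G. s' * g \<in> ideal_gen N"
    using insert.IH by blast
  have "s' * (a * g) \<in> ideal_gen N" if "g \<in> G" for a g
    using that s'(2) self_module.span_scale[of "s' * g" N a] by (simp add: mult.left_commute)
  then have "?T G \<subseteq> {y. s' * y \<in> ideal_gen N}"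
    by (intro ideal_gen_minimal ring_ideal_colon ring_ideal_ideal_gen)
      (auto intro: self_module.span_base ring_ideal_mult_left)
  then have "s' * (w * x) \<in> ideal_gen N" using wx by blast
  moreover have "w * (s' * g) \<in> ideal_gen N" if "g \<in> G" for g
    using that s'(2) ring_ideal_mult_left[OF ring_ideal_ideal_gen] by blast
  ultimately have "\<forall>g\<in>insert x G. (w * s') * g \<in> ideal_gen N"
    by (simp add: mult.assoc mult.left_commute[of s'])
  moreover have "w * s' \<notin> origin_ideal" using s' w by (simp add: origin_ideal_complement)
  ultimately show ?case by blast
qed

section \<open>Comparing the Jacobian ideals of f and f + h\<close>

lemma ideal_power_scale_subset:
  assumes "\<And>x. x \<in> I \<Longrightarrow> s * x \<in> J" and "x \<in> ideal_power I k"
  shows "s ^ k * x \<in> ideal_power J k"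
  using assms(2)
proof (induction k arbitrary: x)
  case (Suc k)
  have "ideal_prod I (ideal_power I k) \<subseteq> {x. s ^ Suc k * x \<in> ideal_power J (Suc k)}"
  proof (intro ideal_prod_subset ring_ideal_colon ring_ideal_ideal_power CollectI)
    fix a b assume "a \<in> I" "b \<in> ideal_power I k"
    then have "(s * a) * (s ^ k * b) \<in> ideal_power J (Suc k)"
      using assms(1) Suc.IH by (simp add: ideal_prodI)
    then show "s ^ Suc k * (a * b) \<in> ideal_power J (Suc k)" by (simp only: power_Suc mult_ac)
  qed
  then show ?case using Suc.prems by auto
qed simp

text \<open>Each generator of Jac(f) is a generator of Jac(f + h) minus an element of m Jac(f), with
  m the maximal ideal. So Jac(f) is contained in Jac(f + h) + m Jac(f), and Nakayama's lemma
  provides s.\<close>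

lemma Jac_scale_subset_Jac_perturbation:
  fixes f h :: "('n::finite, 'a::field) mpoly"
  assumes h: "h \<in> ideal_prod origin_ideal (Jac f)"
    and dh: "\<And>i. partial_deriv i h \<in> ideal_prod origin_ideal (Jac f)"
  obtains s where "s \<notin> origin_ideal" "\<And>x. x \<in> Jac f \<Longrightarrow> s * x \<in> Jac (f + h)"
proof -
  let ?G = "insert f (range (\<lambda>i. partial_deriv i f))"
  let ?T = "ideal_gen (Jac (f + h) \<union> {a * g | a g. a \<in> origin_ideal \<and> g \<in> ?G})"
  have prod: "ideal_prod origin_ideal (Jac f) \<subseteq> ?T"
  proof (intro ideal_prod_subset ring_ideal_ideal_gen)
    fix a b :: "('n, 'a) mpoly"
    assume a: "a \<in> origin_ideal" and b: "b \<in> Jac f"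
    have "a * g \<in> ?T" if "g \<in> ?G" for g using a that by (intro self_module.span_base) blast
    then have "Jac f \<subseteq> {b. a * b \<in> ?T}"
      unfolding Jac_def by (intro ideal_gen_minimal ring_ideal_colon ring_ideal_ideal_gen) blast
    then show "a * b \<in> ?T" using b by blast
  qed
  have sub: "Jac (f + h) \<subseteq> ?T" by (auto intro: self_module.span_base)
  have diff: "x - y \<in> ?T" if "x \<in> Jac (f + h)" "y \<in> ideal_prod origin_ideal (Jac f)" for x y
    using that sub prod by (intro self_module.span_diff) auto
  have "g \<in> ?T" if g: "g \<in> ?G" for g
  proof -
    consider "g = f" | i where "g = partial_deriv i f" using g by blast
    then show ?thesis
    proof cases
      case 1
      then show ?thesis using diff[OF self_in_Jac h] by simp
    next
      case 2
      then show ?thesis using diff[OF partial_deriv_in_Jac dh, of i i] by (simp add: partial_deriv_add)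
    qed
  qed
  then have "\<exists>s. s \<notin> origin_ideal \<and> s * g \<in> ?T" if "g \<in> ?G" for g
    using that origin_ideal_complement(1) by (intro exI[of _ 1]) auto
  then obtain s where s: "s \<notin> origin_ideal" "\<forall>g\<in>?G. s * g \<in> ideal_gen (Jac (f + h))"
    using nakayama_origin_ideal[of ?G "Jac (f + h)"] by auto
  have "ideal_gen (Jac (f + h)) = Jac (f + h)"
    by (simp add: self_module.span_eq_iff)
  with s(2) have "\<forall>g\<in>?G. s * g \<in> Jac (f + h)" by (simp only:)
  then have "Jac f \<subseteq> {x. s * x \<in> Jac (f + h)}"
    by (intro Jac_subset ring_ideal_colon ring_ideal_Jac) simp_all
  then show ?thesis using that s(1) by blast
qed

theorem mainTheorem1:
  fixes f :: "('n::{finite,linorder}, 'a::field) mpoly"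
  assumes "prime CHAR('a)"
    and "F_finite_field TYPE('a)"
    and "f \<in> origin_ideal"
    and "primary_to origin_ideal (Jac f)"
  shows "\<exists>N M. N < M \<and>
    (\<forall>h \<in> ideal_power origin_ideal N. fpt (to_local f) = fpt (to_local (f + h))) \<and>
    (\<forall>h \<in> ideal_power origin_ideal M.
      (\<forall>t::real. 0 \<le> t \<and> t < 1 \<longrightarrow>
        test_ideal (to_local f) t = test_ideal (to_local (f + h)) t) \<and>
      F_jumping_numbers (to_local f) = F_jumping_numbers (to_local (f + h)))"
proof -
  note p = assms(1) and f = assms(3)
  let ?m = "origin_ideal :: ('n, 'a) mpoly set"
  have radical: "?m = ideal_radical (Jac f)"
    using assms(4) by (simp add: primary_to_def)
  obtain k where k: "ideal_power ?m k \<subseteq> Jac f"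
    using origin_ideal_power_subset[OF ring_ideal_Jac] radical by blast
  \<comment> \<open>The 4k places h in Jac(f)^4. The 2 leaves room for one derivative and one factor
    of m: h and its derivatives lie in m^(k+1), hence in m Jac(f).\<close>
  define N where "N = k * 4 + 2"
  have main: "f + h \<in> origin_ideal \<and> f \<noteq> 0 \<and> f + h \<noteq> 0 \<and>
      (\<forall>t<1. test_ideal (to_local f) t = test_ideal (to_local (f + h)) t)"
    if h: "h \<in> ideal_power ?m N" for h
  proof -
    have "ideal_power ?m (Suc k) \<subseteq> ideal_prod ?m (Jac f)"
      using k by (simp only: ideal_power.simps, intro ideal_prod_subset) (auto intro: ideal_prodI)
    then have in_prod: "x \<in> ideal_prod ?m (Jac f)" if "x \<in> ideal_power ?m (k * 4 + 1)" for x
      using that ideal_power_antimono[of "Suc k" "k * 4 + 1" ?m] by auto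
    have h': "h \<in> ideal_prod ?m (Jac f)"
      using h in_prod ideal_power_Suc_subset[of ?m "k * 4 + 1"] by (auto simp: N_def)
    have dh: "partial_deriv i h \<in> ideal_prod ?m (Jac f)" for i
      using h partial_deriv_ideal_power[OF ring_ideal_origin_ideal, of h "k * 4 + 1" i] in_prod
      by (simp add: N_def)
    obtain s where s: "s \<notin> ?m" "\<And>x. x \<in> Jac f \<Longrightarrow> s * x \<in> Jac (f + h)"
      using Jac_scale_subset_Jac_perturbation[OF h' dh] by blast
    have "ideal_power ?m N \<subseteq> ideal_power (ideal_power ?m k) 4"
      using ideal_power_antimono[of "k * 4" N ?m] ideal_power_ideal_power[of ?m k 4] by (auto simp: N_def)
    also have "\<dots> \<subseteq> ideal_power (Jac f) 4" by (rule ideal_power_mono[OF k])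
    finally have h4: "h \<in> ideal_power (Jac f) 4" using h by blast
    then have "s ^ 4 * h \<in> ideal_power (Jac (f + h)) 4"
      using ideal_power_scale_subset[of "Jac f" s "Jac (f + h)" h 4] s(2) by blast
    then have g4: "s ^ 4 * (f - (f + h)) \<in> ideal_power (Jac (f + h)) 4"
      using self_module.subspace_neg[OF ring_ideal_ideal_power] by fastforce
    \<comment> \<open>The test ideal of f + h lies in that of f with denominator 1; the converse
      uses s^4, one s for each of the four Jacobian factors.\<close>
    have eq: "test_ideal (to_local f) t = test_ideal (to_local (f + h)) t" if "t < 1" for t
      using test_ideal_local_perturbation_subset[OF p origin_ideal_complement(1), of "f + h" f t]
        test_ideal_local_perturbation_subset[OF p origin_ideal_power_complement[OF s(1)] g4 that]
        h4 that by simp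
    have "h \<in> ?m" using h' ideal_prod_subset[of ?m ?m "Jac f"] ring_ideal_mult_right[of ?m] by blast
    then have "f + h \<in> ?m" using f by (simp add: self_module.subspace_add)
    \<comment> \<open>Needed for 1 to be a jumping number of both. Jac(0) = 0, whereas Jac(f)
      contains a power of a variable (\<open>undefined\<close> is an arbitrary one), and s maps
      nonzero elements of Jac(f) to nonzero elements of Jac(f + h).\<close>
    moreover have "f \<noteq> 0 \<and> f + h \<noteq> 0"
    proof -
      have zero: "Jac (0 :: ('n, 'a) mpoly) \<subseteq> {0}"
        by (intro Jac_subset) (simp_all add: self_module.subspace_single_0)
      have "Var undefined \<in> ?m" unfolding origin_ideal_def by (rule self_module.span_base) simp
      then obtain j where j: "Var undefined ^ j \<in> Jac f" unfolding radical ideal_radical_def by blast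
      have "Var undefined ^ j \<noteq> (0 :: ('n, 'a) mpoly)"
        by (metis Var_power lookup_single_eq lookup_zero zero_neq_one)
      with j obtain y where y: "y \<in> Jac f" "y \<noteq> 0" by blast
      have "s \<noteq> 0" using s(1) origin_ideal_complement(2) by metis
      then have "s * y \<noteq> 0" using y(2) by simp
      moreover have "s * y \<in> Jac (f + h)" by (rule s(2)[OF y(1)])
      ultimately show ?thesis using y zero by fastforce
    qed
    ultimately show ?thesis using eq by blast
  qed
  have "fpt (to_local f) = fpt (to_local (f + h))" if "h \<in> ideal_power ?m N" for h
    using main[OF that] by (intro fpt_local_cong[OF p f]) auto
  moreover have "F_jumping_numbers (to_local f) = F_jumping_numbers (to_local (f + h))"
    if "h \<in> ideal_power ?m (Suc N)" for h
    using main[of h] that ideal_power_Suc_subset[of ?m N]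
    by (intro F_jumping_numbers_local_cong[OF p f]) auto
  \<comment> \<open>One bound serves both claims; \<open>Suc N\<close> is chosen to make N < M
    strict.\<close>
  ultimately show ?thesis
    using main ideal_power_Suc_subset[of ?m N] by (intro exI[of _ N] exI[of _ "Suc N"]) blast
qed

end
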